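(* For every $m\in\{2,\dots,n\}$, $$\mathrm{Gap}(m,m-1)\ \ge\ G(m).$$ As a result, for every $l\in\{1,\dots,n-1\}$, $$\mathrm{Gap}(n,l)\ \ge\ \prod_{m=l+1}^n G(m).$$
   Context: Setting. Let $n\ge 2$ be an integer, $[n]=\{1,\dots,n\}$, and let $(\mathsf{X}_i,\mathcal{B}_i,\mu_i)$, $i\in[n]$, be $\sigma$-finite measure spaces in which singletons are measurable. Let $\mathbf{X}=(X_1,\dots,X_n)$ be a random element, $X_i$ taking values in $\mathsf{X}_i$, whose joint distribution $\Pi$ on $\mathsf{X}=\mathsf{X}_1\times\dots\times\mathsf{X}_n$ has density $\pi$ with respect to $\mu_1\times\dots\times\mu_n$; $\pi$ is a measurable function specified everywhere on $\mathsf{X}$. For $\Gamma\subset[n]$ write $-\Gamma=[n]\setminus\Gamma$; for nonempty $\Gamma$ let $\mathsf{X}_\Gamma=\prod_{i\in\Gamma}\mathsf{X}_i$, $\mu_\Gamma=\prod_{i\in\Gamma}\mu_i$, and let $\mathbf{X}_\Gamma$, $\mathbf{x}_\Gamma$ denote the subvectors of $\mathbf{X}$, $\mathbf{x}\in\mathsf{X}$ with indices in $\Gamma$ (in increasing order). The marginal density of $\mathbf{X}_\Gamma$ is $\pi_\Gamma(\mathbf{y})=\int_{\mathsf{X}_{-\Gamma}}\pi(\mathbf{x})\,\mu_{-\Gamma}(d\mathbf{x}_{-\Gamma})$ with $\mathbf{x}_\Gamma=\mathbf{y}$, and $\pi_{[n]}=\pi$. For disjoint nonempty $\Lambda,\Gamma\subset[n]$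 and $\mathbf{y}\in\mathsf{X}_\Lambda$ with $\pi_\Lambda(\mathbf{y})>0$, the conditional density is $\pi_{\Gamma\mid\Lambda}(\mathbf{z}\mid\mathbf{y})=\pi_{\Lambda\cup\Gamma}(\mathbf{x}_{\Lambda\cup\Gamma})/\pi_\Lambda(\mathbf{y})$ where $\mathbf{x}_\Lambda=\mathbf{y}$, $\mathbf{x}_\Gamma=\mathbf{z}$; if $\pi_\Lambda(\mathbf{y})=0$, $\pi_{\Gamma\mid\Lambda}(\cdot\mid\mathbf{y})$ is an arbitrary probability density on $\mathsf{X}_\Gamma$. If $\Lambda=\emptyset$, $\pi_{\Gamma\mid\Lambda}(\cdot\mid\mathbf{y})$ means $\pi_\Gamma(\cdot)$ (and conditions on $\mathbf{y}$, such as $\pi_\Lambda(\mathbf{y})>0$, are vacuous). Spectral gap. For a probability measure $\nu$, $L_0^2(\nu)$ is the Hilbert space of real square-integrable functions with $\int f\,d\nu=0$, with norm $\|\cdot\|_\nu$. A Markov kernel $K$ reversible with respect to $\nu$ acts on $L_0^2(\nu)$ by $Kf(x)=\int f(x')K(x,dx')$; $\|K\|_\nu=\sup_{f\in L_0^2(\nu),f\ne0}\|Kf\|_\nu/\|f\|_\nu$, and the spectral gap of $K$ is $1-\|K\|_\nu$. Gibbs samplers. For $\Lambda\subset[n]$ with $|\Lambda|\le n-1$, $\mathbf{y}\in\mathsf{X}_\Lambda$ and $l\in\{1,\dots,n-|\Lambda|\}$, the random-scan Gibbs sampler targeting $\pi_{-\Lambda\mid\Lambda}(\cdot\mid\mathbf{y})$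 with block size $l$ is the Markov chain on $\mathsf{X}_{-\Lambda}$ that moves from $\mathbf{z}$ as follows: let $\mathbf{x}$ satisfy $\mathbf{x}_\Lambda=\mathbf{y}$, $\mathbf{x}_{-\Lambda}=\mathbf{z}$; choose $\Gamma\subset-\Lambda$ with $|\Gamma|=l$ uniformly at random; draw $\mathbf{w}\in\mathsf{X}_\Gamma$ from $\pi_{\Gamma\mid-\Gamma}(\cdot\mid\mathbf{x}_{-\Gamma})$; let $\mathbf{x}'_\Gamma=\mathbf{w}$, $\mathbf{x}'_{-\Gamma}=\mathbf{x}_{-\Gamma}$; the new state is $\mathbf{x}'_{-\Lambda}$. When $\pi_\Lambda(\mathbf{y})>0$ this chain is reversible with respect to $\pi_{-\Lambda\mid\Lambda}(\cdot\mid\mathbf{y})$; let $\mathrm{gap}(\Lambda,\mathbf{y},l)$ be its spectral gap. For $l\in\{1,\dots,n\}$ and $m\in\{l,\dots,n\}$, $$\mathrm{Gap}(m,l)=\min_{\Lambda\subset[n],\,|\Lambda|=n-m}\ \inf_{\mathbf{y}\in\mathsf{X}_\Lambda,\ \pi_\Lambda(\mathbf{y})>0}\mathrm{gap}(\Lambda,\mathbf{y},l).$$ In particular $\mathrm{Gap}(n,l)$ is the spectral gap of the Gibbs sampler targeting $\pi$ with block size $l$. Random walks. For $\Lambda\subset[n]$ with $|\Lambda|\le n-1$ and $\mathbf{y}\in\mathsf{X}_\Lambda$, the random walk associated with $(\Lambda,\mathbf{y})$ is the Markov chain on $\bigcup_{i\in-\Lambda}(\{i\}\times\mathsf{X}_i)$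 that moves from $(j,x)$ as follows: choose $j'\in-\Lambda$ uniformly at random; if $j'=j$ set $x'=x$; if $j'\ne j$, draw $x'\in\mathsf{X}_{j'}$ from $\pi_{\{j'\}\mid\Lambda\cup\{j\}}(\cdot\mid\mathbf{x}_{\Lambda\cup\{j\}})$, where $\mathbf{x}_\Lambda=\mathbf{y}$ and $\mathbf{x}_{\{j\}}=x$; the new state is $(j',x')$. When $\pi_\Lambda(\mathbf{y})>0$ it is reversible with respect to the probability measure $\varphi_{\Lambda,\mathbf{y}}$ given by $\varphi_{\Lambda,\mathbf{y}}(\{i\}\times A)=\frac{1}{n-|\Lambda|}\int_A\pi_{\{i\}\mid\Lambda}(x\mid\mathbf{y})\,\mu_i(dx)$ for $i\in-\Lambda$, $A\in\mathcal{B}_i$. Let $g(\Lambda,\mathbf{y})$ be its spectral gap, and for $m\in\{2,\dots,n\}$ let $G(m)=\min_{\Lambda\subset[n],|\Lambda|=n-m}\ \inf_{\mathbf{y}\in\mathsf{X}_\Lambda,\,\pi_\Lambda(\mathbf{y})>0}g(\Lambda,\mathbf{y})$. *)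

theory Defs
  imports "HOL-Probability.Probability"
begin

section \<open>Spectral gap\<close>

text \<open>
  The integral is \<^const>\<open>nn_integral\<close> so that the norm is insensitive to null sets even for
  non-measurable functions: an image under a kernel that is arbitrary on a null set need only agree
  almost everywhere with a measurable function.
\<close>

definition l2_norm :: "'b measure \<Rightarrow> ('b \<Rightarrow> real) \<Rightarrow> ennreal" where
  "l2_norm \<nu> f =
     (let I = \<integral>\<^sup>+ x. ennreal ((f x)\<^sup>2) \<partial>\<nu> in if I = \<infinity> then \<infinity> else ennreal (sqrt (enn2real I)))"

definition L20 :: "'b measure \<Rightarrow> ('b \<Rightarrow> real) set" where
  "L20 \<nu> = {f. f \<in> borel_measurable \<nu> \<and> integrable \<nu> (\<lambda>x. (f x)\<^sup>2) \<and> (\<integral>x. f x \<partial>\<nu>) = 0}"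

definition kernel_op :: "('b \<Rightarrow> 'b measure) \<Rightarrow> ('b \<Rightarrow> real) \<Rightarrow> 'b \<Rightarrow> real" where
  "kernel_op K f x = (\<integral>x'. f x' \<partial>K x)"

text \<open>
  Elements of the Hilbert space are almost-everywhere classes, so being nonzero means having
  nonzero norm.  The supremum over the empty set (when the space is trivial) is \<open>0\<close>.
\<close>

definition kernel_norm :: "'b measure \<Rightarrow> ('b \<Rightarrow> 'b measure) \<Rightarrow> ennreal" where
  "kernel_norm \<nu> K =
     (SUP f\<in>{f \<in> L20 \<nu>. l2_norm \<nu> f \<noteq> 0}. l2_norm \<nu> (kernel_op K f) / l2_norm \<nu> f)"

definition spectral_gap :: "'b measure \<Rightarrow> ('b \<Rightarrow> 'b measure) \<Rightarrow> ereal" where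
  "spectral_gap \<nu> K = 1 - enn2ereal (kernel_norm \<nu> K)"

section \<open>Marginal and conditional densities\<close>

text \<open>
  Throughout, \<open>M i\<close> for \<open>i \<in> {1..n}\<close> are the coordinate spaces with their reference measures, \<open>p\<close> is
  the joint density, and \<open>q \<Gamma> \<Lambda> y\<close> is the density on the \<open>\<Gamma>\<close> coordinates that is used in place of the
  conditional one when the marginal density of the \<open>\<Lambda>\<close> coordinates vanishes at \<open>y\<close>.

  The marginal is a Bochner integral, hence real-valued everywhere; it is \<open>0\<close> on the null set
  where the integral diverges.  For \<open>\<Gamma> = {}\<close> it is the total mass \<open>1\<close>, so that \<open>cond_density\<close>
  with \<open>\<Lambda> = {}\<close> is then the marginal density.
\<close>

definition marginal ::
    "nat \<Rightarrow> (nat \<Rightarrow> 'a measure) \<Rightarrow> ((nat \<Rightarrow> 'a) \<Rightarrow> real) \<Rightarrow> nat set \<Rightarrow> (nat \<Rightarrow> 'a) \<Rightarrow> real" where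
  "marginal n M p \<Gamma> y =
     (\<integral>w. p (merge \<Gamma> ({1..n} - \<Gamma>) (y, w)) \<partial>(Pi\<^sub>M ({1..n} - \<Gamma>) M))"

type_synonym 'a cond_family = "nat set \<Rightarrow> nat set \<Rightarrow> (nat \<Rightarrow> 'a) \<Rightarrow> (nat \<Rightarrow> 'a) \<Rightarrow> real"

definition cond_density ::
    "nat \<Rightarrow> (nat \<Rightarrow> 'a measure) \<Rightarrow> ((nat \<Rightarrow> 'a) \<Rightarrow> real) \<Rightarrow> 'a cond_family \<Rightarrow> 'a cond_family" where
  "cond_density n M p q \<Gamma> \<Lambda> y z =
     (if marginal n M p \<Lambda> y > 0
      then marginal n M p (\<Lambda> \<union> \<Gamma>) (merge \<Lambda> \<Gamma> (y, z)) / marginal n M p \<Lambda> y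
      else q \<Gamma> \<Lambda> y z)"

definition cond_dist ::
    "nat \<Rightarrow> (nat \<Rightarrow> 'a measure) \<Rightarrow> ((nat \<Rightarrow> 'a) \<Rightarrow> real) \<Rightarrow> 'a cond_family \<Rightarrow>
     nat set \<Rightarrow> nat set \<Rightarrow> (nat \<Rightarrow> 'a) \<Rightarrow> (nat \<Rightarrow> 'a) measure" where
  "cond_dist n M p q \<Gamma> \<Lambda> y = density (Pi\<^sub>M \<Gamma> M) (\<lambda>z. ennreal (cond_density n M p q \<Gamma> \<Lambda> y z))"

section \<open>Random-scan Gibbs samplers\<close>

definition gibbs_kernel ::
    "nat \<Rightarrow> (nat \<Rightarrow> 'a measure) \<Rightarrow> ((nat \<Rightarrow> 'a) \<Rightarrow> real) \<Rightarrow> 'a cond_family \<Rightarrow>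
     nat set \<Rightarrow> (nat \<Rightarrow> 'a) \<Rightarrow> nat \<Rightarrow> (nat \<Rightarrow> 'a) \<Rightarrow> (nat \<Rightarrow> 'a) measure" where
  "gibbs_kernel n M p q \<Lambda> y l z =
     (let x = merge \<Lambda> ({1..n} - \<Lambda>) (y, z) in
      uniform_count_measure {\<Gamma>. \<Gamma> \<subseteq> {1..n} - \<Lambda> \<and> card \<Gamma> = l} \<bind>
        (\<lambda>\<Gamma>. distr (cond_dist n M p q \<Gamma> ({1..n} - \<Gamma>) (restrict x ({1..n} - \<Gamma>)))
                (Pi\<^sub>M ({1..n} - \<Lambda>) M)
                (\<lambda>w. restrict (merge \<Gamma> ({1..n} - \<Gamma>) (w, x)) ({1..n} - \<Lambda>))))"

definition gibbs_gap ::
    "nat \<Rightarrow> (nat \<Rightarrow> 'a measure) \<Rightarrow> ((nat \<Rightarrow> 'a) \<Rightarrow> real) \<Rightarrow> 'a cond_family \<Rightarrow>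
     nat set \<Rightarrow> (nat \<Rightarrow> 'a) \<Rightarrow> nat \<Rightarrow> ereal" where
  "gibbs_gap n M p q \<Lambda> y l =
     spectral_gap (cond_dist n M p q ({1..n} - \<Lambda>) \<Lambda> y) (gibbs_kernel n M p q \<Lambda> y l)"

definition Gap ::
    "nat \<Rightarrow> (nat \<Rightarrow> 'a measure) \<Rightarrow> ((nat \<Rightarrow> 'a) \<Rightarrow> real) \<Rightarrow> 'a cond_family \<Rightarrow> nat \<Rightarrow> nat \<Rightarrow> ereal" where
  "Gap n M p q m l =
     Min ((\<lambda>\<Lambda>. INF y\<in>{y \<in> space (Pi\<^sub>M \<Lambda> M). marginal n M p \<Lambda> y > 0}. gibbs_gap n M p q \<Lambda> y l)
       ` {\<Lambda>. \<Lambda> \<subseteq> {1..n} \<and> card \<Lambda> = n - m})"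

section \<open>Random walks\<close>

text \<open>The measurable space \<open>\<Union>i\<in>I. {i} \<times> space (M i)\<close> with the disjoint-union sigma-algebra.\<close>

definition walk_space :: "nat set \<Rightarrow> (nat \<Rightarrow> 'a measure) \<Rightarrow> (nat \<times> 'a) measure" where
  "walk_space I M = sigma (SIGMA i:I. space (M i)) {{i} \<times> A | i A. i \<in> I \<and> A \<in> sets (M i)}"

definition walk_kernel ::
    "nat \<Rightarrow> (nat \<Rightarrow> 'a measure) \<Rightarrow> ((nat \<Rightarrow> 'a) \<Rightarrow> real) \<Rightarrow> 'a cond_family \<Rightarrow>
     nat set \<Rightarrow> (nat \<Rightarrow> 'a) \<Rightarrow> nat \<times> 'a \<Rightarrow> (nat \<times> 'a) measure" where
  "walk_kernel n M p q \<Lambda> y = (\<lambda>(j, x).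
     uniform_count_measure ({1..n} - \<Lambda>) \<bind>
       (\<lambda>j'. if j' = j then return (walk_space ({1..n} - \<Lambda>) M) (j, x)
             else distr (cond_dist n M p q {j'} (\<Lambda> \<union> {j}) (merge \<Lambda> {j} (y, \<lambda>_. x)))
                    (walk_space ({1..n} - \<Lambda>) M) (\<lambda>w. (j', w j'))))"

definition walk_stationary ::
    "nat \<Rightarrow> (nat \<Rightarrow> 'a measure) \<Rightarrow> ((nat \<Rightarrow> 'a) \<Rightarrow> real) \<Rightarrow> 'a cond_family \<Rightarrow>
     nat set \<Rightarrow> (nat \<Rightarrow> 'a) \<Rightarrow> (nat \<times> 'a) measure" where
  "walk_stationary n M p q \<Lambda> y =
     uniform_count_measure ({1..n} - \<Lambda>) \<bind>
       (\<lambda>i. distr (cond_dist n M p q {i} \<Lambda> y) (walk_space ({1..n} - \<Lambda>) M) (\<lambda>w. (i, w i)))"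

definition walk_gap ::
    "nat \<Rightarrow> (nat \<Rightarrow> 'a measure) \<Rightarrow> ((nat \<Rightarrow> 'a) \<Rightarrow> real) \<Rightarrow> 'a cond_family \<Rightarrow>
     nat set \<Rightarrow> (nat \<Rightarrow> 'a) \<Rightarrow> ereal" where
  "walk_gap n M p q \<Lambda> y =
     spectral_gap (walk_stationary n M p q \<Lambda> y) (walk_kernel n M p q \<Lambda> y)"

definition walk_Gap ::
    "nat \<Rightarrow> (nat \<Rightarrow> 'a measure) \<Rightarrow> ((nat \<Rightarrow> 'a) \<Rightarrow> real) \<Rightarrow> 'a cond_family \<Rightarrow> nat \<Rightarrow> ereal" where
  "walk_Gap n M p q m =
     Min ((\<lambda>\<Lambda>. INF y\<in>{y \<in> space (Pi\<^sub>M \<Lambda> M). marginal n M p \<Lambda> y > 0}. walk_gap n M p q \<Lambda> y)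
       ` {\<Lambda>. \<Lambda> \<subseteq> {1..n} \<and> card \<Lambda> = n - m})"

end

theory Submission
  imports Defs
begin

text \<open>
  On a fibre, where the coordinates outside a set \<open>I\<close> of size \<open>m\<close> are fixed, let \<open>T\<close> be the operator that
  turns a function \<open>h\<close> on the state space of the random walk into the function
  \<open>x \<mapsto> (\<Sum>i\<in>I. h (i, x i)) / m\<close> on the fibre.  Its adjoint is \<open>(T* F) (i, a) = E(F | x i = a)\<close>.  The
  sampler with block size \<open>m - 1\<close> is \<open>T T*\<close> and the walk is \<open>T* T\<close>, so the two have the same norm on
  centred functions.  This gives the first inequality fibre by fibre; only one direction is needed, and
  it comes from a few applications of Young's inequality (\<open>sum_E_sq_le\<close>, \<open>gibbs_norm_le_walk_norm\<close>).
  
  For the product bound, the sampler with block size \<open>l\<close> targeting the joint distribution is the average of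
  the orthogonal projections \<open>E(\<cdot> | x outside \<Gamma>)\<close> over the blocks \<open>\<Gamma>\<close> of size \<open>l\<close>.  It is positive
  semidefinite, so its norm is determined by its quadratic form \<open>energy F l\<close>
  (\<open>average_projections_norm\<close>).  Applying the first part on all fibres of dimension \<open>m\<close>, integrating over the
  fixed coordinates and averaging over their position gives
  \<open>|F|^2 - energy F (m - 1) \<ge> G(m) (|F|^2 - energy F m)\<close> (\<open>telescope_step\<close>).  For centred \<open>F\<close> the
  energy vanishes at \<open>m = n\<close>, and iterating down to \<open>l\<close> multiplies the factors \<open>G(m)\<close>.
  
  All conditional distributions are represented by measures \<open>resample \<Gamma> x\<close> on the full product, in which
  the coordinates in \<open>\<Gamma>\<close> are redrawn and the others kept at \<open>x\<close>.  These obey the tower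
  property (\<open>resample_tower\<close>) at every point whose conditioning density is positive, so each of them is a
  conditioning kernel on every such fibre.  The arbitrary densities at the other points enter on null sets
  only and do not affect the norms.
\<close>

section \<open>Square-integrable functions\<close>

text \<open>
  Square-integrability with respect to a measure, for functions rather than almost-everywhere classes.
\<close>

definition sq_int :: "'b measure \<Rightarrow> ('b \<Rightarrow> real) \<Rightarrow> bool" where
  "sq_int N f \<longleftrightarrow> f \<in> borel_measurable N \<and> integrable N (\<lambda>x. (f x)\<^sup>2)"

lemma sq_intD[dest]: "sq_int N f \<Longrightarrow> f \<in> borel_measurable N" "sq_int N f \<Longrightarrow> integrable N (\<lambda>x. (f x)\<^sup>2)"
  by (auto simp: sq_int_def)

lemma sq_int_integrable_mult:
  assumes "sq_int N f" "sq_int N g" shows "integrable N (\<lambda>x. f x * g x)"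
proof (rule Bochner_Integration.integrable_bound)
  show "integrable N (\<lambda>x. (f x)\<^sup>2 + (g x)\<^sup>2)" using assms by (auto simp: sq_int_def)
  show "(\<lambda>x. f x * g x) \<in> borel_measurable N" using assms by (auto simp: sq_int_def)
  have "\<bar>a * b\<bar> \<le> a\<^sup>2 + b\<^sup>2" for a b :: real
  proof -
    have "0 \<le> (\<bar>a\<bar> - \<bar>b\<bar>)\<^sup>2" by simp
    hence "2 * (\<bar>a\<bar> * \<bar>b\<bar>) \<le> a\<^sup>2 + b\<^sup>2" by (simp add: power2_diff)
    moreover have "0 \<le> \<bar>a\<bar> * \<bar>b\<bar>" by simp
    ultimately show ?thesis unfolding abs_mult by linarith
  qed
  thus "AE x in N. norm (f x * g x) \<le> norm ((f x)\<^sup>2 + (g x)\<^sup>2)" by simp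
qed

lemma sq_int_add: assumes "sq_int N f" "sq_int N g" shows "sq_int N (\<lambda>x. f x + g x)"
  using assms sq_int_integrable_mult[OF assms]
  by (auto simp: sq_int_def power2_sum mult.assoc)

lemma sq_int_cmult: assumes "sq_int N f" shows "sq_int N (\<lambda>x. c * f x)"
  using assms by (auto simp: sq_int_def power_mult_distrib)

lemma sq_int_0[simp]: "sq_int N (\<lambda>x. 0)" by (simp add: sq_int_def)

lemma sq_int_sum: assumes "\<And>i. i \<in> S \<Longrightarrow> sq_int N (f i)" shows "sq_int N (\<lambda>x. \<Sum>i\<in>S. f i x)"
  using assms by (induction S rule: infinite_finite_induct) (auto intro: sq_int_add)

lemma sq_int_divide: "sq_int N f \<Longrightarrow> sq_int N (\<lambda>x. f x / c)"
  using sq_int_cmult[of N f "1/c"] by simp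

lemma sq_int_cong_AE:
  assumes "sq_int N f" "g \<in> borel_measurable N" "AE x in N. f x = g x" shows "sq_int N g"
proof -
  have "integrable N (\<lambda>x. (g x)\<^sup>2)"
    by (rule integrable_cong_AE_imp[of N "\<lambda>x. (f x)\<^sup>2"]) (use assms in \<open>auto simp: sq_int_def\<close>)
  thus ?thesis using assms by (simp add: sq_int_def)
qed

text \<open>
  This serves as the Cauchy-Schwarz inequality, to which it amounts when \<open>t\<close> is the quotient of the
  norms of \<open>g\<close> and \<open>f\<close>.
\<close>

lemma integral_young:
  assumes "sq_int N f" "sq_int N g" "t > 0"
  shows "2 * (\<integral>x. f x * g x \<partial>N) \<le> t * (\<integral>x. (f x)\<^sup>2 \<partial>N) + (\<integral>x. (g x)\<^sup>2 \<partial>N) / t"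
proof -
  have *: "2 * (a * b) \<le> t * a\<^sup>2 + b\<^sup>2 / t" for a b :: real
  proof -
    have "0 \<le> (t * a - b)\<^sup>2 / t" using \<open>t > 0\<close> by simp
    also have "\<dots> = t * a\<^sup>2 + b\<^sup>2 / t - 2 * (a * b)" using \<open>t > 0\<close>
      by (simp add: field_simps power2_eq_square)
    finally show ?thesis by simp
  qed
  have "(\<integral>x. 2 * (f x * g x) \<partial>N) \<le> (\<integral>x. t * (f x)\<^sup>2 + (g x)\<^sup>2 / t \<partial>N)"
    using assms sq_int_integrable_mult[OF assms(1,2)]
    by (intro integral_mono * ) (auto simp: sq_int_def)
  also have "\<dots> = t * (\<integral>x. (f x)\<^sup>2 \<partial>N) + (\<integral>x. (g x)\<^sup>2 \<partial>N) / t"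
    using assms by (subst Bochner_Integration.integral_add) (auto simp: sq_int_def)
  finally show ?thesis by simp
qed

lemma power2_average_le:
  fixes a :: "'i \<Rightarrow> real"
  assumes "finite S" "S \<noteq> {}"
  shows "((\<Sum>i\<in>S. a i) / card S)\<^sup>2 \<le> (\<Sum>i\<in>S. (a i)\<^sup>2) / card S"
proof -
  have c: "real (card S) > 0" using assms by (simp add: card_gt_0_iff)
  have "(\<Sum>i\<in>S. a i)\<^sup>2 \<le> (\<Sum>i\<in>S. (a i)\<^sup>2) * card S"
    using Cauchy_Schwarz_ineq_sum[of a "\<lambda>_. 1" S] by simp
  thus ?thesis using c by (simp add: field_simps power2_eq_square)
qed

context prob_space begin

lemma sq_int_integrable: "sq_int M f \<Longrightarrow> integrable M f"
  using square_integrable_imp_integrable by (auto simp: sq_int_def)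

lemma sq_int_const[simp]: "sq_int M (\<lambda>_. c)" by (simp add: sq_int_def)

lemma square_expectation_le:
  assumes "sq_int M f" shows "(\<integral>x. f x \<partial>M)\<^sup>2 \<le> (\<integral>x. (f x)\<^sup>2 \<partial>M)"
  using variance_positive[of f] variance_eq[of f] sq_int_integrable[OF assms] sq_intD[OF assms]
  by linarith

end

section \<open>Conditioning kernels\<close>

text \<open>
  A conditioning kernel of a probability measure \<open>N\<close> is a kernel that preserves \<open>N\<close> and is almost
  surely constant along its own moves.  It behaves like a regular conditional distribution given some
  sub-sigma-algebra, which need not be named.  The measures \<open>K x\<close> are only required to be
  subprobabilities, so that the kernel can be null at exceptional points; it is a probability measure
  almost surely by invariance.
\<close>

locale cond_kernel = prob_space N for N :: "'b measure" +
  fixes K :: "'b \<Rightarrow> 'b measure"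
  assumes K_meas[measurable]: "K \<in> N \<rightarrow>\<^sub>M subprob_algebra N"
    and K_inv: "\<And>u. u \<in> borel_measurable N \<Longrightarrow> (\<integral>\<^sup>+x. (\<integral>\<^sup>+x'. u x' \<partial>K x) \<partial>N) = (\<integral>\<^sup>+x. u x \<partial>N)"
    and K_const: "AE x in N. AE x' in K x. K x' = K x"
begin

abbreviation E :: "('b \<Rightarrow> real) \<Rightarrow> 'b \<Rightarrow> real" where
  "E \<equiv> kernel_op K"

lemma sets_K: "x \<in> space N \<Longrightarrow> sets (K x) = sets N"
  using measurable_space[OF K_meas] by (auto simp: space_subprob_algebra)

lemma subprob_K: "x \<in> space N \<Longrightarrow> subprob_space (K x)"
  using measurable_space[OF K_meas] by (auto simp: space_subprob_algebra)

lemma meas_K: "x \<in> space N \<Longrightarrow> borel_measurable (K x) = borel_measurable N"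
  by (intro measurable_cong_sets sets_K) auto

lemma nn_K_meas[measurable]: "u \<in> borel_measurable N \<Longrightarrow> (\<lambda>x. \<integral>\<^sup>+x'. u x' \<partial>K x) \<in> borel_measurable N"
  by (rule measurable_compose[OF K_meas nn_integral_measurable_subprob_algebra])

lemma E_meas[measurable]: "f \<in> borel_measurable N \<Longrightarrow> E f \<in> borel_measurable N"
  unfolding kernel_op_def[abs_def] by (rule measurable_compose[OF K_meas integral_measurable_subprob_algebra])

lemma AE_prob: "AE x in N. prob_space (K x)"
proof -
  let ?m = "\<lambda>x. emeasure (K x) (space N)"
  have [measurable]: "?m \<in> borel_measurable N" by measurable
  have le: "x \<in> space N \<Longrightarrow> ?m x \<le> 1" for x
    using subprob_K[of x] subprob_space.subprob_emeasure_le_1 by blast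
  have m: "?m x = (\<integral>\<^sup>+x'. 1 \<partial>K x)" if "x \<in> space N" for x
    using sets_eq_imp_space_eq[OF sets_K[OF that]] by simp
  have int1: "(\<integral>\<^sup>+x. ?m x \<partial>N) = 1"
    using K_inv[of "\<lambda>_. 1"] emeasure_space_1 by (simp add: m cong: nn_integral_cong)
  have "(\<integral>\<^sup>+x. 1 - ?m x \<partial>N) = (\<integral>\<^sup>+x. 1 \<partial>N) - (\<integral>\<^sup>+x. ?m x \<partial>N)"
    using le int1 by (intro nn_integral_diff) auto
  also have "\<dots> = 0" using int1 emeasure_space_1 by simp
  finally have "AE x in N. 1 - ?m x = 0" by (subst (asm) nn_integral_0_iff_AE) auto
  thus ?thesis
  proof (rule AE_mp, intro AE_I2 impI)
    fix x assume x: "x \<in> space N" "1 - ?m x = 0"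
    hence "?m x = 1" using le[of x] by (simp add: antisym diff_eq_0_iff_ennreal)
    thus "prob_space (K x)" using sets_eq_imp_space_eq[OF sets_K[OF x(1)]]
      by (intro prob_spaceI) simp
  qed
qed

lemma AE_K: assumes "AE x in N. P x" shows "AE x in N. AE x' in K x. P x'"
proof -
  obtain A where A: "A \<in> sets N" "emeasure N A = 0" "{x \<in> space N. \<not> P x} \<subseteq> A"
    using AE_E[OF assms] by metis
  have "(\<integral>\<^sup>+x. (\<integral>\<^sup>+x'. indicator A x' \<partial>K x) \<partial>N) = 0" using A by (simp add: K_inv)
  hence "AE x in N. (\<integral>\<^sup>+x'. indicator A x' \<partial>K x) = 0"
    using A by (subst (asm) nn_integral_0_iff_AE) auto
  with AE_space show ?thesis
  proof eventually_elim
    fix x assume x: "x \<in> space N" "(\<integral>\<^sup>+x'. indicator A x' \<partial>K x) = 0"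
    show "AE x' in K x. P x'"
    proof (rule AE_I)
      show "{x' \<in> space (K x). \<not> P x'} \<subseteq> A" using A sets_eq_imp_space_eq[OF sets_K[OF x(1)]] by auto
      show "A \<in> sets (K x)" using A sets_K[OF x(1)] by simp
      thus "emeasure (K x) A = 0" using x by simp
    qed
  qed
qed

lemma AE_integrable:
  fixes f :: "'b \<Rightarrow> real"
  assumes f: "integrable N f" shows "AE x in N. integrable (K x) f"
proof -
  have [measurable]: "f \<in> borel_measurable N" using f by auto
  have "(\<integral>\<^sup>+x. (\<integral>\<^sup>+x'. norm (f x') \<partial>K x) \<partial>N) \<noteq> \<infinity>"
    using integrable_iff_bounded[THEN iffD1, THEN conjunct2, OF f] by (subst K_inv) simp_all
  hence "AE x in N. (\<integral>\<^sup>+x'. norm (f x') \<partial>K x) \<noteq> \<infinity>" by (intro nn_integral_PInf_AE) auto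
  thus ?thesis
    by (rule AE_mp, intro AE_I2 impI) (auto simp: integrable_iff_bounded meas_K less_top)
qed

lemma E_nonneg_integral:
  assumes f: "integrable N f" and nn: "\<And>x. 0 \<le> f x"
  shows "integrable N (E f)" "(\<integral>x. E f x \<partial>N) = (\<integral>x. f x \<partial>N)"
proof -
  have [measurable]: "f \<in> borel_measurable N" using f by auto
  have e: "AE x in N. ennreal (E f x) = (\<integral>\<^sup>+x'. f x' \<partial>K x)"
    using AE_integrable[OF f] by eventually_elim (simp add: kernel_op_def nn_integral_eq_integral nn)
  have e2: "(\<integral>\<^sup>+x. ennreal (E f x) \<partial>N) = ennreal (\<integral>x. f x \<partial>N)"
    using f by (subst nn_integral_cong_AE[OF e]) (simp add: K_inv nn_integral_eq_integral nn)
  have nnE: "0 \<le> E f x" for x by (simp add: kernel_op_def nn)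
  show i: "integrable N (E f)"
    using e2 by (intro integrableI_nn_integral_finite[where x="\<integral>x. f x \<partial>N"]) (auto simp: nnE)
  show "(\<integral>x. E f x \<partial>N) = (\<integral>x. f x \<partial>N)"
    using e2 by (subst integral_eq_nn_integral) (auto simp: nnE nn)
qed

lemma E_integral:
  assumes f: "integrable N f"
  shows "integrable N (E f)" "(\<integral>x. E f x \<partial>N) = (\<integral>x. f x \<partial>N)"
proof -
  have [measurable]: "f \<in> borel_measurable N" using f by auto
  let ?p = "\<lambda>x. max 0 (f x)" and ?m = "\<lambda>x. max 0 (- f x)"
  have i: "integrable N ?p" "integrable N ?m" using f by auto
  have s: "f x = ?p x - ?m x" for x by auto
  have e: "AE x in N. E f x = E ?p x - E ?m x"
    using AE_integrable[OF i(1)] AE_integrable[OF i(2)]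
    by eventually_elim (simp add: kernel_op_def s[symmetric] flip: Bochner_Integration.integral_diff)
  note p = E_nonneg_integral[OF i(1)] and m = E_nonneg_integral[OF i(2)]
  show "integrable N (E f)"
    by (rule integrable_cong_AE_imp[of N "\<lambda>x. E ?p x - E ?m x"]) (use e p m in auto)
  have "(\<integral>x. E f x \<partial>N) = (\<integral>x. E ?p x - E ?m x \<partial>N)" using e by (intro integral_cong_AE) auto
  also have "\<dots> = (\<integral>x. ?p x - ?m x \<partial>N)" using p m i by simp
  also have "\<dots> = (\<integral>x. f x \<partial>N)" by (simp flip: s)
  finally show "(\<integral>x. E f x \<partial>N) = (\<integral>x. f x \<partial>N)" .
qed

lemma AE_sq_int: assumes "sq_int N f" shows "AE x in N. sq_int (K x) f"
proof -
  have "AE x in N. integrable (K x) (\<lambda>x. (f x)\<^sup>2)" using assms by (intro AE_integrable) auto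
  thus ?thesis by (rule AE_mp, intro AE_I2 impI) (use assms in \<open>auto simp: sq_int_def meas_K\<close>)
qed

lemma E_sq_le: assumes "sq_int N f" shows "AE x in N. (E f x)\<^sup>2 \<le> E (\<lambda>x. (f x)\<^sup>2) x"
  using AE_sq_int[OF assms] AE_prob
  by eventually_elim (simp add: kernel_op_def prob_space.square_expectation_le)

lemma E_sq_int: assumes "sq_int N f" shows "sq_int N (E f)"
  unfolding sq_int_def
proof
  have [measurable]: "f \<in> borel_measurable N" using assms by auto
  show "E f \<in> borel_measurable N" by simp
  show "integrable N (\<lambda>x. (E f x)\<^sup>2)"
  proof (rule Bochner_Integration.integrable_bound)
    show "integrable N (E (\<lambda>x. (f x)\<^sup>2))" using assms by (intro E_integral) auto
    show "AE x in N. norm ((E f x)\<^sup>2) \<le> norm (E (\<lambda>x. (f x)\<^sup>2) x)"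
      using E_sq_le[OF assms] by eventually_elim simp
  qed simp
qed

lemma E_contraction: assumes "sq_int N f" shows "(\<integral>x. (E f x)\<^sup>2 \<partial>N) \<le> (\<integral>x. (f x)\<^sup>2 \<partial>N)"
proof -
  have f2: "integrable N (\<lambda>x. (f x)\<^sup>2)" using assms by auto
  have "(\<integral>x. (E f x)\<^sup>2 \<partial>N) \<le> (\<integral>x. E (\<lambda>x. (f x)\<^sup>2) x \<partial>N)"
    using E_sq_le[OF assms] E_sq_int[OF assms] E_integral[OF f2]
    by (intro integral_mono_AE) auto
  thus ?thesis using E_integral[OF f2] by simp
qed

text \<open>
  Together with invariance this says that \<open>E\<close> is an orthogonal projection: inside \<open>K x\<close> the factor
  \<open>E f\<close> is constant and comes out of the integral.
\<close>

lemma E_self_adjoint: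
  assumes f: "sq_int N f" and g: "sq_int N g"
  shows "(\<integral>x. E f x * g x \<partial>N) = (\<integral>x. E f x * E g x \<partial>N)"
proof -
  have i: "integrable N (\<lambda>x. E f x * g x)" by (intro sq_int_integrable_mult E_sq_int f g)
  have "(\<integral>x. E f x * g x \<partial>N) = (\<integral>x. E (\<lambda>x. E f x * g x) x \<partial>N)" using E_integral[OF i] by simp
  also have "\<dots> = (\<integral>x. E f x * E g x \<partial>N)"
  proof (rule integral_cong_AE)
    have *: "(\<integral>x'. E f x' * g x' \<partial>K x) = E f x * E g x"
      if x: "x \<in> space N" and c: "AE x' in K x. K x' = K x" for x
    proof -
      have "(\<integral>x'. E f x' * g x' \<partial>K x) = (\<integral>x'. E f x * g x' \<partial>K x)"
      proof (rule integral_cong_AE)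
        show "AE x' in K x. E f x' * g x' = E f x * g x'" using c by eventually_elim (simp add: kernel_op_def)
      qed (use f g x in \<open>auto simp: meas_K sq_int_def\<close>)
      thus ?thesis by (simp add: kernel_op_def)
    qed
    show "AE x in N. E (\<lambda>x. E f x * g x) x = E f x * E g x"
      by (rule AE_mp[OF K_const], rule AE_I2) (auto simp: * kernel_op_def[of K "\<lambda>x. E f x * g x"])
  qed (use sq_intD[OF f] sq_intD[OF g] in measurable)
  finally show ?thesis .
qed

end

section \<open>Averages of conditioning kernels\<close>

text \<open>
  The first part gives the quadratic form of an average of conditional expectations as the average of
  the squared norms of the conditional expectations.
\<close>

lemma average_projections_form:
  assumes S: "finite S" "S \<noteq> {}" and K: "\<And>s. s \<in> S \<Longrightarrow> cond_kernel N (K s)"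
    and f: "sq_int N f" and g: "sq_int N g"
  shows "sq_int N (\<lambda>x. (\<Sum>s\<in>S. kernel_op (K s) f x) / card S)"
    and "(\<integral>x. (\<Sum>s\<in>S. kernel_op (K s) f x) / card S * g x \<partial>N) =
         (\<Sum>s\<in>S. \<integral>x. kernel_op (K s) f x * kernel_op (K s) g x \<partial>N) / card S"
proof -
  have Ef: "sq_int N (kernel_op (K s) f)" if "s \<in> S" for s
    using cond_kernel.E_sq_int[OF K[OF that] f] .
  show "sq_int N (\<lambda>x. (\<Sum>s\<in>S. kernel_op (K s) f x) / card S)"
    by (intro sq_int_divide sq_int_sum Ef)
  have "(\<integral>x. (\<Sum>s\<in>S. kernel_op (K s) f x) / card S * g x \<partial>N) =
      (\<integral>x. (\<Sum>s\<in>S. kernel_op (K s) f x * g x) / card S \<partial>N)"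
    by (simp add: sum_distrib_right)
  also have "\<dots> = (\<Sum>s\<in>S. \<integral>x. kernel_op (K s) f x * g x \<partial>N) / card S"
    using sq_int_integrable_mult[OF Ef g] by simp
  also have "\<dots> = (\<Sum>s\<in>S. \<integral>x. kernel_op (K s) f x * kernel_op (K s) g x \<partial>N) / card S"
    by (simp add: cond_kernel.E_self_adjoint[OF K f g])
  finally show "(\<integral>x. (\<Sum>s\<in>S. kernel_op (K s) f x) / card S * g x \<partial>N) =
         (\<Sum>s\<in>S. \<integral>x. kernel_op (K s) f x * kernel_op (K s) g x \<partial>N) / card S" .
qed

text \<open>
  The average \<open>P\<close> is positive semidefinite, hence a bound \<open>c\<close> for its quadratic form on centred
  functions is a bound for its norm there: both \<open>f\<close> and \<open>P f\<close> are inserted in the form.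
\<close>

lemma average_projections_norm:
  assumes S: "finite S" "S \<noteq> {}" and K: "\<And>s. s \<in> S \<Longrightarrow> cond_kernel N (K s)"
    and c: "c \<ge> 0"
    and form: "\<And>g. sq_int N g \<Longrightarrow> (\<integral>x. g x \<partial>N) = 0 \<Longrightarrow>
      (\<Sum>s\<in>S. \<integral>x. (kernel_op (K s) g x)\<^sup>2 \<partial>N) / card S \<le> c * (\<integral>x. (g x)\<^sup>2 \<partial>N)"
    and f: "sq_int N f" "(\<integral>x. f x \<partial>N) = 0"
  shows "(\<integral>x. ((\<Sum>s\<in>S. kernel_op (K s) f x) / card S)\<^sup>2 \<partial>N) \<le> c\<^sup>2 * (\<integral>x. (f x)\<^sup>2 \<partial>N)"
proof -
  define P where "P = (\<lambda>x. (\<Sum>s\<in>S. kernel_op (K s) f x) / card S)"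
  obtain s0 where "s0 \<in> S" using S by auto
  interpret prob_space N using K[OF \<open>s0 \<in> S\<close>] by (simp add: cond_kernel_def)
  have P: "sq_int N P" unfolding P_def by (rule average_projections_form[OF S K f(1) f(1)])
  have Ef: "sq_int N (kernel_op (K s) f)" if "s \<in> S" for s
    using cond_kernel.E_sq_int[OF K[OF that] f(1)] .
  have EP: "sq_int N (kernel_op (K s) P)" if "s \<in> S" for s
    using cond_kernel.E_sq_int[OF K[OF that] P] .
  have "(\<integral>x. P x \<partial>N) = (\<Sum>s\<in>S. \<integral>x. kernel_op (K s) f x \<partial>N) / card S"
    unfolding P_def using Ef by (simp add: sq_int_integrable)
  also have "\<dots> = 0" using cond_kernel.E_integral(2)[OF K] f by (simp add: sq_int_integrable)
  finally have P0: "(\<integral>x. P x \<partial>N) = 0" .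
  have c0: "real (card S) > 0" using S by (simp add: card_gt_0_iff)
  define b where "b = (\<integral>x. (P x)\<^sup>2 \<partial>N)"
  define a where "a = (\<integral>x. (f x)\<^sup>2 \<partial>N)"
  \<comment> \<open>Young's inequality for each pair of projections of \<open>f\<close> and \<open>P f\<close>; below, \<open>t = c\<close> is the useful choice.\<close>
  have young: "2 * b \<le> t * (c * a) + (c * b) / t" if t: "t > 0" for t
  proof -
    have "2 * b = 2 * ((\<Sum>s\<in>S. \<integral>x. kernel_op (K s) f x * kernel_op (K s) P x \<partial>N) / card S)"
      unfolding b_def using average_projections_form(2)[OF S K f(1) P]
      by (simp add: P_def power2_eq_square)
    also have "\<dots> = (\<Sum>s\<in>S. 2 * (\<integral>x. kernel_op (K s) f x * kernel_op (K s) P x \<partial>N)) / card S"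
      by (simp add: sum_distrib_left)
    also have "\<dots> \<le> (\<Sum>s\<in>S. t * (\<integral>x. (kernel_op (K s) f x)\<^sup>2 \<partial>N) + (\<integral>x. (kernel_op (K s) P x)\<^sup>2 \<partial>N) / t) / card S"
      using t by (intro divide_right_mono sum_mono integral_young Ef EP) auto
    also have "\<dots> = t * ((\<Sum>s\<in>S. \<integral>x. (kernel_op (K s) f x)\<^sup>2 \<partial>N) / card S)
        + ((\<Sum>s\<in>S. \<integral>x. (kernel_op (K s) P x)\<^sup>2 \<partial>N) / card S) / t"
      by (simp add: sum.distrib sum_distrib_left sum_divide_distrib add_divide_distrib mult.commute)
    also have "\<dots> \<le> t * (c * a) + (c * b) / t"
      unfolding a_def b_def using t
      by (intro add_mono mult_left_mono divide_right_mono form f P P0) auto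
    finally show ?thesis .
  qed
  have "b \<le> c\<^sup>2 * a"
  proof (cases "c = 0")
    case True with young[of 1] show ?thesis by simp
  next
    case False with young[of c] c show ?thesis by (simp add: power2_eq_square)
  qed
  thus ?thesis by (simp add: a_def b_def P_def)
qed

section \<open>Resampling kernels of a joint density\<close>

text \<open>
  A probability density \<open>p\<close> on a finite product of sigma-finite spaces.  The index set \<open>{1..n}\<close> is a
  parameter \<open>U\<close> of its own, so that the simplifier does not rewrite the interval.
\<close>

locale joint_density =
  fixes U :: "nat set" and n :: nat and M :: "nat \<Rightarrow> 'a measure" and p :: "(nat \<Rightarrow> 'a) \<Rightarrow> real"
  assumes U_eq: "U = {1..n}"
    and sigma_finite_M: "\<And>i. i \<in> U \<Longrightarrow> sigma_finite_measure (M i)"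
    and singleton_M: "\<And>i x. i \<in> U \<Longrightarrow> x \<in> space (M i) \<Longrightarrow> {x} \<in> sets (M i)"
    and p_meas[measurable]: "p \<in> borel_measurable (Pi\<^sub>M U M)"
    and p_nonneg: "\<And>x. x \<in> space (Pi\<^sub>M U M) \<Longrightarrow> p x \<ge> 0"
    and prob_p: "prob_space (density (Pi\<^sub>M U M) (\<lambda>x. ennreal (p x)))"
begin

abbreviation \<Omega> :: "(nat \<Rightarrow> 'a) measure" where "\<Omega> \<equiv> Pi\<^sub>M U M"

text \<open>
  The point \<open>x\<close> with the coordinates in \<open>\<Gamma>\<close> replaced by those of \<open>w\<close>.
\<close>

definition upd :: "nat set \<Rightarrow> (nat \<Rightarrow> 'a) \<Rightarrow> (nat \<Rightarrow> 'a) \<Rightarrow> nat \<Rightarrow> 'a" where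
  "upd \<Gamma> x w = merge \<Gamma> (U - \<Gamma>) (w, x)"

text \<open>
  Integration of \<open>u\<close> over the \<open>\<Gamma>\<close> coordinates, the others being kept at \<open>x\<close>.  For the density this
  is the extended-real marginal \<open>Z \<Gamma>\<close> of the coordinates outside \<open>\<Gamma>\<close>.
\<close>

definition block_integral :: "nat set \<Rightarrow> ((nat \<Rightarrow> 'a) \<Rightarrow> ennreal) \<Rightarrow> (nat \<Rightarrow> 'a) \<Rightarrow> ennreal" where
  "block_integral \<Gamma> u x = (\<integral>\<^sup>+w. u (upd \<Gamma> x w) \<partial>Pi\<^sub>M \<Gamma> M)"

abbreviation Z :: "nat set \<Rightarrow> (nat \<Rightarrow> 'a) \<Rightarrow> ennreal" where
  "Z \<Gamma> \<equiv> block_integral \<Gamma> (\<lambda>x. ennreal (p x))"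

text \<open>
  The law of a configuration whose \<open>\<Gamma>\<close> coordinates are redrawn conditionally on the others at \<open>x\<close>, as a
  measure on the full product.  If \<open>Z \<Gamma> x\<close> is \<open>0\<close> or \<open>\<infinity>\<close>, extended-real division makes it the null
  measure, which keeps the kernel measurable.  For \<open>\<Gamma> = U\<close> it is the joint distribution; the
  conditional distribution on a fibre is the case \<open>\<Gamma> = U - \<Lambda>\<close>.
\<close>

definition resample :: "nat set \<Rightarrow> (nat \<Rightarrow> 'a) \<Rightarrow> (nat \<Rightarrow> 'a) measure" where
  "resample \<Gamma> x = distr (density (Pi\<^sub>M \<Gamma> M) (\<lambda>w. ennreal (p (upd \<Gamma> x w)) / Z \<Gamma> x)) \<Omega> (upd \<Gamma> x)"

text \<open>
  The points at which conditioning on the coordinates outside \<open>\<Gamma>\<close> is meaningful, that is, at which the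
  corresponding marginal density is positive and finite.
\<close>

definition regular :: "nat set \<Rightarrow> (nat \<Rightarrow> 'a) \<Rightarrow> bool" where
  "regular \<Gamma> x \<longleftrightarrow> 0 < Z \<Gamma> x \<and> Z \<Gamma> x < \<infinity>"

lemma fin_sub: "\<Gamma> \<subseteq> U \<Longrightarrow> finite \<Gamma>" by (rule finite_subset) (auto simp: U_eq)

lemma product_measure_facts:
  assumes "\<Gamma> \<subseteq> U"
  shows sigma_finite_PiM: "sigma_finite_measure (Pi\<^sub>M \<Gamma> M)"
    and "\<And>\<Gamma>'. \<Gamma>' \<subseteq> \<Gamma> \<Longrightarrow>
      distr (Pi\<^sub>M (\<Gamma> - \<Gamma>') M \<Otimes>\<^sub>M Pi\<^sub>M \<Gamma>' M) (Pi\<^sub>M \<Gamma> M) (merge (\<Gamma> - \<Gamma>') \<Gamma>') = Pi\<^sub>M \<Gamma> M"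
proof -
  \<comment> \<open>Outside \<open>U\<close> the factors are arbitrary; they are replaced by null measures.\<close>
  define M' where "M' i = (if i \<in> U then M i else null_measure (M i))" for i
  have eq: "Pi\<^sub>M \<Delta> M = Pi\<^sub>M \<Delta> M'" if "\<Delta> \<subseteq> \<Gamma>" for \<Delta>
    using that assms by (intro PiM_cong) (auto simp: M'_def)
  interpret product_sigma_finite M'
  proof (rule product_sigma_finite.intro)
    fix i show "sigma_finite_measure (M' i)"
    proof (cases "i \<in> U")
      case True thus ?thesis using sigma_finite_M by (simp add: M'_def)
    next
      case False
      have "finite_measure (null_measure (M i))" by (rule finite_measureI) simp
      hence "sigma_finite_measure (null_measure (M i))" by (simp add: finite_measure_def)
      thus ?thesis using False by (simp add: M'_def)
    qed
  qed
  show "sigma_finite_measure (Pi\<^sub>M \<Gamma> M)"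
    using eq[of \<Gamma>] sigma_finite[of \<Gamma>] fin_sub[OF assms] by simp
  show "distr (Pi\<^sub>M (\<Gamma> - \<Gamma>') M \<Otimes>\<^sub>M Pi\<^sub>M \<Gamma>' M) (Pi\<^sub>M \<Gamma> M) (merge (\<Gamma> - \<Gamma>') \<Gamma>') = Pi\<^sub>M \<Gamma> M"
    if "\<Gamma>' \<subseteq> \<Gamma>" for \<Gamma>'
    using distr_merge[of "\<Gamma> - \<Gamma>'" \<Gamma>'] fin_sub[OF assms] finite_subset[OF that] that
    by (simp add: eq Un_absorb2 Diff_Int_distrib2 Int_commute[of _ \<Gamma>'] Diff_disjoint[of \<Gamma>' \<Gamma>])
qed

lemma upd_meas:
  assumes "\<Gamma> \<subseteq> U" shows "(\<lambda>(x, w). upd \<Gamma> x w) \<in> \<Omega> \<Otimes>\<^sub>M Pi\<^sub>M \<Gamma> M \<rightarrow>\<^sub>M \<Omega>"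
proof -
  have "(\<lambda>z. merge \<Gamma> (U - \<Gamma>) (snd z, restrict (fst z) (U - \<Gamma>))) \<in> \<Omega> \<Otimes>\<^sub>M Pi\<^sub>M \<Gamma> M \<rightarrow>\<^sub>M Pi\<^sub>M (\<Gamma> \<union> (U - \<Gamma>)) M"
    by (rule measurable_compose[OF measurable_Pair measurable_merge])
       (auto intro!: measurable_restrict_subset' measurable_compose[OF measurable_fst] measurable_restrict_subset)
  moreover have "\<Gamma> \<union> (U - \<Gamma>) = U" using assms by auto
  moreover have "(\<lambda>z. merge \<Gamma> (U - \<Gamma>) (snd z, restrict (fst z) (U - \<Gamma>))) = (\<lambda>(x, w). upd \<Gamma> x w)"
    by (auto simp: upd_def merge_def fun_eq_iff)
  ultimately show ?thesis by simp
qed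

lemma upd_meas2[measurable (raw)]:
  assumes "\<Gamma> \<subseteq> U" "f \<in> L \<rightarrow>\<^sub>M \<Omega>" "g \<in> L \<rightarrow>\<^sub>M Pi\<^sub>M \<Gamma> M"
  shows "(\<lambda>t. upd \<Gamma> (f t) (g t)) \<in> L \<rightarrow>\<^sub>M \<Omega>"
  using measurable_compose[OF measurable_Pair[OF assms(2,3)] upd_meas[OF assms(1)]] by simp

lemma upd_meas1[measurable]:
  assumes "\<Gamma> \<subseteq> U" "x \<in> space \<Omega>" shows "upd \<Gamma> x \<in> Pi\<^sub>M \<Gamma> M \<rightarrow>\<^sub>M \<Omega>"
  using upd_meas2[of \<Gamma> "\<lambda>_. x" "Pi\<^sub>M \<Gamma> M" "\<lambda>w. w"] assms by simp

lemma upd_space: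
  "\<Gamma> \<subseteq> U \<Longrightarrow> x \<in> space \<Omega> \<Longrightarrow> w \<in> space (Pi\<^sub>M \<Gamma> M) \<Longrightarrow> upd \<Gamma> x w \<in> space \<Omega>"
  using measurable_space[OF upd_meas1] by blast

lemma upd_apply: "upd \<Gamma> x w i = (if i \<in> \<Gamma> then w i else if i \<in> U then x i else undefined)"
  by (auto simp: upd_def merge_def)

lemma upd_merge:
  "\<Gamma>' \<subseteq> \<Gamma> \<Longrightarrow> \<Gamma> \<subseteq> U \<Longrightarrow> upd \<Gamma> x (merge (\<Gamma> - \<Gamma>') \<Gamma>' (w, v)) = upd \<Gamma>' (upd (\<Gamma> - \<Gamma>') x w) v"
  by (auto simp: fun_eq_iff upd_apply merge_def)

lemma upd_absorb: "\<Gamma> \<subseteq> \<Gamma>' \<Longrightarrow> upd \<Gamma>' (upd \<Gamma> x w) v = upd \<Gamma>' x v"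
  by (auto simp: fun_eq_iff upd_apply)

lemma upd_cong: "restrict x (U - \<Gamma>) = restrict x' (U - \<Gamma>) \<Longrightarrow> upd \<Gamma> x = upd \<Gamma> x'"
  by (auto simp: fun_eq_iff upd_apply restrict_def) metis

lemma block_integral_meas[measurable]:
  assumes "\<Gamma> \<subseteq> U" and [measurable]: "u \<in> borel_measurable \<Omega>"
  shows "block_integral \<Gamma> u \<in> borel_measurable \<Omega>"
proof -
  interpret sigma_finite_measure "Pi\<^sub>M \<Gamma> M" by (rule sigma_finite_PiM[OF assms(1)])
  have "(\<lambda>z. u (case z of (x, w) \<Rightarrow> upd \<Gamma> x w)) \<in> borel_measurable (\<Omega> \<Otimes>\<^sub>M Pi\<^sub>M \<Gamma> M)"
    by (rule measurable_compose[OF upd_meas[OF assms(1)]]) simp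
  from borel_measurable_nn_integral_fst[OF this] show ?thesis
    by (simp add: block_integral_def[abs_def])
qed

lemma block_integral_tower:
  assumes "\<Gamma>' \<subseteq> \<Gamma>" "\<Gamma> \<subseteq> U" "x \<in> space \<Omega>" and u[measurable]: "u \<in> borel_measurable \<Omega>"
  shows "block_integral \<Gamma> u x = block_integral (\<Gamma> - \<Gamma>') (block_integral \<Gamma>' u) x"
proof -
  have G': "\<Gamma>' \<subseteq> U" "\<Gamma> - \<Gamma>' \<subseteq> U" using assms by auto
  interpret sigma_finite_measure "Pi\<^sub>M \<Gamma>' M" by (rule sigma_finite_PiM[OF G'(1)])
  have eq: "\<Gamma> - \<Gamma>' \<union> \<Gamma>' = \<Gamma>" using assms by auto
  have m[measurable]: "merge (\<Gamma> - \<Gamma>') \<Gamma>' \<in> Pi\<^sub>M (\<Gamma> - \<Gamma>') M \<Otimes>\<^sub>M Pi\<^sub>M \<Gamma>' M \<rightarrow>\<^sub>M Pi\<^sub>M \<Gamma> M"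
    using measurable_merge[of "\<Gamma> - \<Gamma>'" \<Gamma>' M] by (simp only: eq)
  have um: "(\<lambda>w. u (upd \<Gamma> x w)) \<in> borel_measurable (Pi\<^sub>M \<Gamma> M)"
    by (rule measurable_compose[OF upd_meas1[OF assms(2,3)] u])
  have "block_integral \<Gamma> u x = (\<integral>\<^sup>+w. u (upd \<Gamma> x w) \<partial>distr (Pi\<^sub>M (\<Gamma> - \<Gamma>') M \<Otimes>\<^sub>M Pi\<^sub>M \<Gamma>' M) (Pi\<^sub>M \<Gamma> M) (merge (\<Gamma> - \<Gamma>') \<Gamma>'))"
    unfolding block_integral_def product_measure_facts(2)[OF assms(2,1)] ..
  also have "\<dots> = (\<integral>\<^sup>+z. u (upd \<Gamma> x (merge (\<Gamma> - \<Gamma>') \<Gamma>' z)) \<partial>(Pi\<^sub>M (\<Gamma> - \<Gamma>') M \<Otimes>\<^sub>M Pi\<^sub>M \<Gamma>' M))"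
    using um by (subst nn_integral_distr) auto
  also have "\<dots> = (\<integral>\<^sup>+w. \<integral>\<^sup>+v. u (upd \<Gamma> x (merge (\<Gamma> - \<Gamma>') \<Gamma>' (w, v))) \<partial>Pi\<^sub>M \<Gamma>' M \<partial>Pi\<^sub>M (\<Gamma> - \<Gamma>') M)"
    by (rule nn_integral_fst[symmetric]) (rule measurable_compose[OF m um])
  also have "\<dots> = block_integral (\<Gamma> - \<Gamma>') (block_integral \<Gamma>' u) x"
    by (simp add: block_integral_def upd_merge[OF assms(1,2)])
  finally show ?thesis .
qed

lemma block_integral_upd: "\<Gamma> \<subseteq> \<Gamma>' \<Longrightarrow> block_integral \<Gamma>' u (upd \<Gamma> x w) = block_integral \<Gamma>' u x"
  by (simp add: block_integral_def upd_absorb)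

lemma block_integral_cong:
  "\<Gamma> \<subseteq> U \<Longrightarrow> x \<in> space \<Omega> \<Longrightarrow> (\<And>x'. x' \<in> space \<Omega> \<Longrightarrow> u x' = v x') \<Longrightarrow> block_integral \<Gamma> u x = block_integral \<Gamma> v x"
  unfolding block_integral_def by (intro nn_integral_cong) (simp add: upd_space)

lemma block_integral_meas_w:
  assumes "\<Gamma> \<subseteq> U" "x \<in> space \<Omega>" "u \<in> borel_measurable \<Omega>"
  shows "(\<lambda>w. u (upd \<Gamma> x w)) \<in> borel_measurable (Pi\<^sub>M \<Gamma> M)"
  by (rule measurable_compose[OF upd_meas1[OF assms(1,2)] assms(3)])

lemma block_integral_cmult:
  assumes "\<Gamma> \<subseteq> U" "x \<in> space \<Omega>" "u \<in> borel_measurable \<Omega>"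
  shows "block_integral \<Gamma> (\<lambda>x. u x * c) x = block_integral \<Gamma> u x * c"
  unfolding block_integral_def using block_integral_meas_w[OF assms] by (rule nn_integral_multc)

lemma sets_resample[simp]: "sets (resample \<Gamma> x) = sets \<Omega>" by (simp add: resample_def)
lemma space_resample[simp]: "space (resample \<Gamma> x) = space \<Omega>" by (simp add: resample_def)
lemma meas_resample[simp]: "measurable (resample \<Gamma> x) L = measurable \<Omega> L"
  by (intro measurable_cong_sets) simp_all

lemma nn_resample:
  assumes "\<Gamma> \<subseteq> U" "x \<in> space \<Omega>" and u[measurable]: "u \<in> borel_measurable \<Omega>"
  shows "(\<integral>\<^sup>+x'. u x' \<partial>resample \<Gamma> x) = block_integral \<Gamma> (\<lambda>x. ennreal (p x) * u x) x / Z \<Gamma> x"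
proof -
  note [measurable] = upd_meas1[OF assms(1,2)]
  have "(\<integral>\<^sup>+x'. u x' \<partial>resample \<Gamma> x) = (\<integral>\<^sup>+w. ennreal (p (upd \<Gamma> x w)) / Z \<Gamma> x * u (upd \<Gamma> x w) \<partial>Pi\<^sub>M \<Gamma> M)"
    unfolding resample_def by (subst nn_integral_distr) (auto simp: nn_integral_density)
  also have "\<dots> = (\<integral>\<^sup>+w. ennreal (p (upd \<Gamma> x w)) * u (upd \<Gamma> x w) / Z \<Gamma> x \<partial>Pi\<^sub>M \<Gamma> M)"
    by (simp add: divide_ennreal_def mult_ac)
  also have "\<dots> = block_integral \<Gamma> (\<lambda>x. ennreal (p x) * u x) x / Z \<Gamma> x"
    unfolding block_integral_def by (rule nn_integral_divide) measurable
  finally show ?thesis .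
qed

lemma ennreal_self_divide: "(z::ennreal) / z = (if 0 < z \<and> z < \<infinity> then 1 else 0)"
  by (cases "z = 0"; cases "z = top")
     (auto simp: ennreal_divide_self less_top zero_less_iff_neq_zero)

lemma resample_mass:
  assumes "\<Gamma> \<subseteq> U" "x \<in> space \<Omega>"
  shows "emeasure (resample \<Gamma> x) (space \<Omega>) = (if regular \<Gamma> x then 1 else 0)"
  using nn_resample[OF assms, of "\<lambda>_. 1"] by (simp add: ennreal_self_divide regular_def)

lemma prob_resample: "\<Gamma> \<subseteq> U \<Longrightarrow> x \<in> space \<Omega> \<Longrightarrow> regular \<Gamma> x \<Longrightarrow> prob_space (resample \<Gamma> x)"
  by (intro prob_spaceI) (simp add: resample_mass)

lemma resample_meas[measurable]:
  assumes "\<Gamma> \<subseteq> U" shows "resample \<Gamma> \<in> \<Omega> \<rightarrow>\<^sub>M subprob_algebra \<Omega>"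
proof (rule measurable_subprob_algebra)
  fix x assume x: "x \<in> space \<Omega>"
  show "subprob_space (resample \<Gamma> x)"
    using x by (intro subprob_spaceI) (simp add: resample_mass[OF assms x], metis empty_iff space_resample)
  show "sets (resample \<Gamma> x) = sets \<Omega>" by simp
next
  fix A assume A[measurable]: "A \<in> sets \<Omega>"
  note [measurable] = block_integral_meas[OF assms]
  have "emeasure (resample \<Gamma> x) A = block_integral \<Gamma> (\<lambda>x. ennreal (p x) * indicator A x) x / Z \<Gamma> x" if "x \<in> space \<Omega>" for x
    using nn_resample[OF assms that, of "indicator A"] by simp
  moreover have "(\<lambda>x. block_integral \<Gamma> (\<lambda>x. ennreal (p x) * indicator A x) x / Z \<Gamma> x) \<in> borel_measurable \<Omega>"
    by measurable
  ultimately show "(\<lambda>x. emeasure (resample \<Gamma> x) A) \<in> borel_measurable \<Omega>"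
    by (simp cong: measurable_cong)
qed

lemma resample_cong: "restrict x (U - \<Gamma>) = restrict x' (U - \<Gamma>) \<Longrightarrow> resample \<Gamma> x = resample \<Gamma> x'"
  using upd_cong[of x \<Gamma> x'] by (simp add: resample_def block_integral_def)

lemma regular_cong: "restrict x (U - \<Gamma>) = restrict x' (U - \<Gamma>) \<Longrightarrow> regular \<Gamma> x = regular \<Gamma> x'"
  using upd_cong[of x \<Gamma> x'] by (simp add: regular_def block_integral_def)

text \<open>
  Measurability of the event uses that singletons of the coordinate spaces are measurable.
\<close>

lemma AE_resample_restrict:
  assumes "\<Gamma> \<subseteq> U" "x \<in> space \<Omega>"
  shows "AE x' in resample \<Gamma> x. restrict x' (U - \<Gamma>) = restrict x (U - \<Gamma>)"
proof -
  note [measurable] = upd_meas1[OF assms]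
  have [measurable]: "Measurable.pred \<Omega> (\<lambda>x'. x' i = x i)" if "i \<in> U - \<Gamma>" for i
  proof -
    have "{x i} \<in> sets (M i)" using that assms by (intro singleton_M) (auto simp: space_PiM)
    moreover have "(\<lambda>x'. x' i) \<in> \<Omega> \<rightarrow>\<^sub>M M i"
      using that by (intro measurable_component_singleton) auto
    ultimately have "{x' \<in> space \<Omega>. x' i \<in> {x i}} \<in> sets \<Omega>" by measurable
    thus ?thesis by (simp add: pred_def)
  qed
  have eq: "restrict x' (U - \<Gamma>) = restrict x (U - \<Gamma>) \<longleftrightarrow> (\<forall>i\<in>U - \<Gamma>. x' i = x i)" for x'
    by (auto simp: restrict_def fun_eq_iff)
  have [measurable]: "Measurable.pred \<Omega> (\<lambda>x'. \<forall>i\<in>U - \<Gamma>. x' i = x i)"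
    using fin_sub[of "U - \<Gamma>"] by (intro pred_intros_finite) auto
  show ?thesis unfolding eq resample_def
    by (subst AE_distr_iff) (auto simp: upd_apply)
qed

text \<open>
  Redrawing \<open>\<Gamma>\<close> and then the smaller block \<open>\<Gamma>'\<close> has the same law as redrawing \<open>\<Gamma>\<close>.  This holds from
  every regular point, not only almost every one, which is what the infimum over conditioning points
  demands.
\<close>

lemma resample_tower:
  assumes "\<Gamma>' \<subseteq> \<Gamma>" "\<Gamma> \<subseteq> U" "x \<in> space \<Omega>" "regular \<Gamma> x" and u[measurable]: "u \<in> borel_measurable \<Omega>"
  shows "(\<integral>\<^sup>+x'. (\<integral>\<^sup>+x''. u x'' \<partial>resample \<Gamma>' x') \<partial>resample \<Gamma> x) = (\<integral>\<^sup>+x'. u x' \<partial>resample \<Gamma> x)"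
proof -
  have G': "\<Gamma>' \<subseteq> U" "\<Gamma> - \<Gamma>' \<subseteq> U" using assms by auto
  note [measurable] = block_integral_meas[OF G'(1)] block_integral_meas[OF G'(2)] block_integral_meas[OF assms(2)]
  define pu where "pu = (\<lambda>x. ennreal (p x) * u x)"
  define v where "v = (\<lambda>x. block_integral \<Gamma>' pu x / Z \<Gamma>' x)"
  have [measurable]: "pu \<in> borel_measurable \<Omega>" "v \<in> borel_measurable \<Omega>" by (simp_all add: pu_def v_def)
  have "(\<integral>\<^sup>+x'. (\<integral>\<^sup>+x''. u x'' \<partial>resample \<Gamma>' x') \<partial>resample \<Gamma> x) = (\<integral>\<^sup>+x'. v x' \<partial>resample \<Gamma> x)"
    by (intro nn_integral_cong) (simp add: nn_resample G' v_def pu_def)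
  also have "\<dots> = block_integral \<Gamma> (\<lambda>x. ennreal (p x) * v x) x / Z \<Gamma> x" by (simp add: nn_resample assms)
  also have "block_integral \<Gamma> (\<lambda>x. ennreal (p x) * v x) x = block_integral (\<Gamma> - \<Gamma>') (block_integral \<Gamma>' (\<lambda>x. ennreal (p x) * v x)) x"
    by (rule block_integral_tower[OF assms(1-3)]) simp
  also have "\<dots> = block_integral (\<Gamma> - \<Gamma>') (\<lambda>x. Z \<Gamma>' x * v x) x"
  proof (rule block_integral_cong[OF G'(2) assms(3)])
    fix x' assume x': "x' \<in> space \<Omega>"
    have "block_integral \<Gamma>' (\<lambda>x. ennreal (p x) * v x) x' = block_integral \<Gamma>' (\<lambda>x. ennreal (p x) * v x') x'"
      unfolding block_integral_def[of \<Gamma>'] by (simp add: v_def block_integral_upd)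
    also have "\<dots> = Z \<Gamma>' x' * v x'" by (rule block_integral_cmult[OF G'(1) x']) simp
    finally show "block_integral \<Gamma>' (\<lambda>x. ennreal (p x) * v x) x' = Z \<Gamma>' x' * v x'" .
  qed
  also have "\<dots> = block_integral (\<Gamma> - \<Gamma>') (block_integral \<Gamma>' pu) x"
  proof -
    note um = block_integral_meas_w[OF G'(2) assms(3)]
    have "block_integral (\<Gamma> - \<Gamma>') (Z \<Gamma>') x < \<infinity>"
      using assms(4) block_integral_tower[OF assms(1-3), of "\<lambda>x. ennreal (p x)"] by (simp add: regular_def)
    hence fin: "AE w in Pi\<^sub>M (\<Gamma> - \<Gamma>') M. Z \<Gamma>' (upd (\<Gamma> - \<Gamma>') x w) \<noteq> \<infinity>"
      unfolding block_integral_def[of "\<Gamma> - \<Gamma>'"] by (intro nn_integral_PInf_AE um) auto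
    \<comment> \<open>Where \<open>Z\<close> vanishes, so does the density almost everywhere on the block, and both sides are \<open>0\<close>.\<close>
    have eq: "Z \<Gamma>' x' * v x' = block_integral \<Gamma>' pu x'" if "Z \<Gamma>' x' \<noteq> \<infinity>" "x' \<in> space \<Omega>" for x'
    proof (cases "Z \<Gamma>' x' = 0")
      case True
      hence "AE w in Pi\<^sub>M \<Gamma>' M. ennreal (p (upd \<Gamma>' x' w)) = 0"
        using block_integral_meas_w[OF G'(1) that(2), of "\<lambda>x. ennreal (p x)"] by (simp add: block_integral_def nn_integral_0_iff_AE)
      hence "block_integral \<Gamma>' pu x' = 0" unfolding block_integral_def
        by (subst nn_integral_0_iff_AE) (auto intro!: block_integral_meas_w G' that simp: pu_def)
      thus ?thesis using True by simp
    next
      case False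
      thus ?thesis using that(1) unfolding v_def
        by (simp add: ennreal_times_divide ennreal_mult_divide_eq mult.commute)
    qed
    have "AE w in Pi\<^sub>M (\<Gamma> - \<Gamma>') M.
       Z \<Gamma>' (upd (\<Gamma> - \<Gamma>') x w) * v (upd (\<Gamma> - \<Gamma>') x w) = block_integral \<Gamma>' pu (upd (\<Gamma> - \<Gamma>') x w)"
      using fin AE_space by eventually_elim (intro eq upd_space[OF G'(2) assms(3)])
    thus ?thesis unfolding block_integral_def[of "\<Gamma> - \<Gamma>'"] by (rule nn_integral_cong_AE)
  qed
  also have "\<dots> = block_integral \<Gamma> pu x" by (rule block_integral_tower[OF assms(1-3), symmetric]) simp
  also have "block_integral \<Gamma> pu x / Z \<Gamma> x = (\<integral>\<^sup>+x'. u x' \<partial>resample \<Gamma> x)" by (simp add: nn_resample assms pu_def)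
  finally show ?thesis .
qed

lemma cond_kernel_resample:
  assumes "\<Gamma>' \<subseteq> \<Gamma>" "\<Gamma> \<subseteq> U" "x \<in> space \<Omega>" "regular \<Gamma> x"
  shows "cond_kernel (resample \<Gamma> x) (resample \<Gamma>')"
proof -
  have G': "\<Gamma>' \<subseteq> U" using assms by auto
  interpret prob_space "resample \<Gamma> x" by (rule prob_resample[OF assms(2-4)])
  show ?thesis
  proof
    show "resample \<Gamma>' \<in> resample \<Gamma> x \<rightarrow>\<^sub>M subprob_algebra (resample \<Gamma> x)"
      using resample_meas[OF G'] subprob_algebra_cong[of "resample \<Gamma> x" \<Omega>] by simp
    show "u \<in> borel_measurable (resample \<Gamma> x) \<Longrightarrow>
        (\<integral>\<^sup>+x'. (\<integral>\<^sup>+x''. u x'' \<partial>resample \<Gamma>' x') \<partial>resample \<Gamma> x) = (\<integral>\<^sup>+x'. u x' \<partial>resample \<Gamma> x)" for u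
      by (rule resample_tower[OF assms]) simp
    show "AE x' in resample \<Gamma> x. AE x'' in resample \<Gamma>' x'. resample \<Gamma>' x'' = resample \<Gamma>' x'"
    proof (rule AE_I2)
      fix x' assume "x' \<in> space (resample \<Gamma> x)"
      hence "x' \<in> space \<Omega>" by simp
      from AE_resample_restrict[OF G' this] show "AE x'' in resample \<Gamma>' x'. resample \<Gamma>' x'' = resample \<Gamma>' x'"
        by eventually_elim (rule resample_cong)
    qed
  qed
qed

lemma AE_regular:
  assumes "\<Gamma>' \<subseteq> \<Gamma>" "\<Gamma> \<subseteq> U" "x \<in> space \<Omega>" "regular \<Gamma> x"
  shows "AE x' in resample \<Gamma> x. regular \<Gamma>' x'"
  using cond_kernel.AE_prob[OF cond_kernel_resample[OF assms]] AE_space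
proof eventually_elim
  case (elim x')
  have "\<Gamma>' \<subseteq> U" using assms by auto
  with prob_space.emeasure_space_1[OF elim(1)] show ?case
    using resample_mass[of \<Gamma>' x'] elim(2) by (auto split: if_splits)
qed

section \<open>Marginal and conditional distributions\<close>

lemma marginal_Z:
  assumes "\<Gamma> \<subseteq> U" "x \<in> space \<Omega>"
  shows "marginal n M p (U - \<Gamma>) (restrict x (U - \<Gamma>)) = enn2real (Z \<Gamma> x)"
proof -
  note [measurable] = upd_meas1[OF assms]
  have UU: "{1..n} - (U - \<Gamma>) = \<Gamma>" using assms by (auto simp: U_eq)
  have "merge (U - \<Gamma>) \<Gamma> (restrict x (U - \<Gamma>), w) = upd \<Gamma> x w" for w
    using assms by (auto simp: fun_eq_iff upd_apply merge_def)
  thus ?thesis unfolding marginal_def UU block_integral_def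
    by (simp add: integral_eq_nn_integral upd_space[OF assms] p_nonneg)
qed

lemma marginal_pos:
  assumes "\<Gamma> \<subseteq> U" "x \<in> space \<Omega>"
  shows "marginal n M p (U - \<Gamma>) (restrict x (U - \<Gamma>)) > 0 \<longleftrightarrow> regular \<Gamma> x"
  by (simp add: marginal_Z[OF assms] regular_def enn2real_positive_iff)

lemma sets_cond_dist[simp]: "sets (cond_dist n M p q \<Gamma> \<Lambda> y) = sets (Pi\<^sub>M \<Gamma> M)"
  by (simp add: cond_dist_def)

text \<open>
  Every conditional distribution with a positive marginal at the conditioning point is the image of a
  resampling measure under a coordinate projection; the arbitrary densities are not involved.
\<close>

lemma cond_dist_resample:
  assumes "\<Gamma>1 \<subseteq> \<Gamma>" "\<Gamma> \<subseteq> U" "x \<in> space \<Omega>" "regular \<Gamma> x"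
  shows "cond_dist n M p q \<Gamma>1 (U - \<Gamma>) (restrict x (U - \<Gamma>))
       = distr (resample \<Gamma> x) (Pi\<^sub>M \<Gamma>1 M) (\<lambda>x'. restrict x' \<Gamma>1)"
proof (rule measure_eqI)
  let ?C = "cond_dist n M p q \<Gamma>1 (U - \<Gamma>) (restrict x (U - \<Gamma>))"
  let ?D = "\<Gamma> - \<Gamma>1"
  show "sets ?C = sets (distr (resample \<Gamma> x) (Pi\<^sub>M \<Gamma>1 M) (\<lambda>x'. restrict x' \<Gamma>1))" by simp
  fix A assume "A \<in> sets ?C"
  hence A[measurable]: "A \<in> sets (Pi\<^sub>M \<Gamma>1 M)" by simp
  have G: "\<Gamma>1 \<subseteq> U" "?D \<subseteq> U" "?D \<subseteq> \<Gamma>" "\<Gamma> - ?D = \<Gamma>1" using assms by auto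
  note [measurable] = block_integral_meas[OF G(1)] block_integral_meas[OF G(2)] block_integral_meas[OF assms(2)] upd_meas1[OF G(1) assms(3)]
  have [measurable]: "(\<lambda>x'. restrict x' \<Gamma>1) \<in> \<Omega> \<rightarrow>\<^sub>M Pi\<^sub>M \<Gamma>1 M"
    by (rule measurable_restrict_subset[OF G(1)])
  have cd: "cond_density n M p q \<Gamma>1 (U - \<Gamma>) (restrict x (U - \<Gamma>)) z
       = enn2real (Z ?D (upd \<Gamma>1 x z)) / enn2real (Z \<Gamma> x)" if z: "z \<in> space (Pi\<^sub>M \<Gamma>1 M)" for z
  proof -
    have *: "U - \<Gamma> \<union> \<Gamma>1 = U - ?D" using assms by auto
    have "merge (U - \<Gamma>) \<Gamma>1 (restrict x (U - \<Gamma>), z) = restrict (upd \<Gamma>1 x z) (U - ?D)"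
      using assms(1,2) by (auto simp: fun_eq_iff upd_apply merge_def)
    thus ?thesis
      using marginal_pos[OF assms(2,3)] assms(4) marginal_Z[OF assms(2,3)]
        marginal_Z[OF G(2) upd_space[OF G(1) assms(3) z]]
      by (simp add: cond_density_def *)
  qed
  have ZD: "Z \<Gamma> x = (\<integral>\<^sup>+z. Z ?D (upd \<Gamma>1 x z) \<partial>Pi\<^sub>M \<Gamma>1 M)"
    using block_integral_tower[OF G(3) assms(2,3), of "\<lambda>x. ennreal (p x)"] G(4) by (simp add: block_integral_def[of \<Gamma>1])
  have "(\<integral>\<^sup>+z. Z ?D (upd \<Gamma>1 x z) \<partial>Pi\<^sub>M \<Gamma>1 M) \<noteq> \<infinity>"
    using assms(4) unfolding regular_def ZD[symmetric] by auto
  hence fin: "AE z in Pi\<^sub>M \<Gamma>1 M. Z ?D (upd \<Gamma>1 x z) \<noteq> \<infinity>" by (intro nn_integral_PInf_AE) auto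
  have cdm: "(\<lambda>z. cond_density n M p q \<Gamma>1 (U - \<Gamma>) (restrict x (U - \<Gamma>)) z) \<in> borel_measurable (Pi\<^sub>M \<Gamma>1 M)"
    by (subst measurable_cong[OF cd]) measurable
  have "emeasure ?C A = (\<integral>\<^sup>+z. ennreal (cond_density n M p q \<Gamma>1 (U - \<Gamma>) (restrict x (U - \<Gamma>)) z) * indicator A z \<partial>Pi\<^sub>M \<Gamma>1 M)"
    unfolding cond_dist_def using cdm by (subst emeasure_density) auto
  also have "\<dots> = (\<integral>\<^sup>+z. Z ?D (upd \<Gamma>1 x z) * indicator A z / Z \<Gamma> x \<partial>Pi\<^sub>M \<Gamma>1 M)"
  proof (rule nn_integral_cong_AE)
    show "AE z in Pi\<^sub>M \<Gamma>1 M. ennreal (cond_density n M p q \<Gamma>1 (U - \<Gamma>) (restrict x (U - \<Gamma>)) z) * indicator A z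
        = Z ?D (upd \<Gamma>1 x z) * indicator A z / Z \<Gamma> x"
      using fin AE_space
    proof eventually_elim
      case (elim z)
      have "ennreal (enn2real (Z ?D (upd \<Gamma>1 x z)) / enn2real (Z \<Gamma> x)) = Z ?D (upd \<Gamma>1 x z) / Z \<Gamma> x"
        using elim(1) assms(4) unfolding regular_def
        by (cases "Z \<Gamma> x"; cases "Z ?D (upd \<Gamma>1 x z)") (auto simp: divide_ennreal)
      thus ?case using elim by (simp add: cd divide_ennreal_def mult_ac)
    qed
  qed
  also have "\<dots> = (\<integral>\<^sup>+z. Z ?D (upd \<Gamma>1 x z) * indicator A z \<partial>Pi\<^sub>M \<Gamma>1 M) / Z \<Gamma> x"
    by (rule nn_integral_divide) measurable
  also have "(\<integral>\<^sup>+z. Z ?D (upd \<Gamma>1 x z) * indicator A z \<partial>Pi\<^sub>M \<Gamma>1 M)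
     = block_integral \<Gamma>1 (block_integral ?D (\<lambda>x. ennreal (p x) * indicator A (restrict x \<Gamma>1))) x"
    unfolding block_integral_def[of \<Gamma>1]
  proof (rule nn_integral_cong)
    fix z assume z: "z \<in> space (Pi\<^sub>M \<Gamma>1 M)"
    let ?x = "upd \<Gamma>1 x z"
    have r: "restrict (upd ?D ?x w) \<Gamma>1 = z" for w
      using z G(1) by (auto simp: fun_eq_iff upd_apply space_PiM PiE_def extensional_def restrict_def)
    show "Z ?D ?x * indicator A z = block_integral ?D (\<lambda>x. ennreal (p x) * indicator A (restrict x \<Gamma>1)) ?x"
      using block_integral_cmult[OF G(2) upd_space[OF G(1) assms(3) z], of "\<lambda>x. ennreal (p x)" "indicator A z"]
      by (simp add: block_integral_def[of ?D] r)
  qed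
  also have "\<dots> = block_integral \<Gamma> (\<lambda>x. ennreal (p x) * indicator A (restrict x \<Gamma>1)) x"
    using block_integral_tower[OF G(3) assms(2,3), of "\<lambda>x. ennreal (p x) * indicator A (restrict x \<Gamma>1)"] G(4) by simp
  also have "\<dots> / Z \<Gamma> x = (\<integral>\<^sup>+x'. indicator A (restrict x' \<Gamma>1) \<partial>resample \<Gamma> x)"
    by (rule nn_resample[OF assms(2,3), symmetric]) measurable
  also have "\<dots> = (\<integral>\<^sup>+z. indicator A z \<partial>distr (resample \<Gamma> x) (Pi\<^sub>M \<Gamma>1 M) (\<lambda>x'. restrict x' \<Gamma>1))"
    by (subst nn_integral_distr) auto
  also have "\<dots> = emeasure (distr (resample \<Gamma> x) (Pi\<^sub>M \<Gamma>1 M) (\<lambda>x'. restrict x' \<Gamma>1)) A"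
    by (rule nn_integral_indicator) simp
  finally show "emeasure ?C A = emeasure (distr (resample \<Gamma> x) (Pi\<^sub>M \<Gamma>1 M) (\<lambda>x'. restrict x' \<Gamma>1)) A" .
qed

lemma distr_cond_dist_upd:
  assumes "\<Gamma> \<subseteq> U" "x \<in> space \<Omega>" "regular \<Gamma> x"
  shows "distr (cond_dist n M p q \<Gamma> (U - \<Gamma>) (restrict x (U - \<Gamma>))) \<Omega> (upd \<Gamma> x) = resample \<Gamma> x"
proof -
  note [measurable] = upd_meas1[OF assms(1,2)]
  have [measurable]: "(\<lambda>x'. restrict x' \<Gamma>) \<in> \<Omega> \<rightarrow>\<^sub>M Pi\<^sub>M \<Gamma> M"
    by (rule measurable_restrict_subset[OF assms(1)])
  have "distr (cond_dist n M p q \<Gamma> (U - \<Gamma>) (restrict x (U - \<Gamma>))) \<Omega> (upd \<Gamma> x)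
      = distr (resample \<Gamma> x) \<Omega> (\<lambda>x'. upd \<Gamma> x (restrict x' \<Gamma>))"
    unfolding cond_dist_resample[OF order_refl assms] by (subst distr_distr) (auto simp: comp_def)
  also have "\<dots> = distr (density (Pi\<^sub>M \<Gamma> M) (\<lambda>w. ennreal (p (upd \<Gamma> x w)) / Z \<Gamma> x)) \<Omega>
      (\<lambda>w. upd \<Gamma> x (restrict (upd \<Gamma> x w) \<Gamma>))"
    unfolding resample_def by (subst distr_distr) (auto simp: comp_def)
  also have "\<dots> = resample \<Gamma> x" unfolding resample_def
    by (intro distr_cong) (auto simp: fun_eq_iff upd_apply)
  finally show ?thesis .
qed

lemma resample_U:
  assumes "x \<in> space \<Omega>"
  shows "regular U x" "resample U x = density \<Omega> (\<lambda>x. ennreal (p x))"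
proof -
  have u: "upd U x w = w" if "w \<in> space \<Omega>" for w
    using that by (auto simp: fun_eq_iff upd_apply space_PiM PiE_def extensional_def)
  have "Z U x = (\<integral>\<^sup>+w. ennreal (p w) \<partial>\<Omega>)" unfolding block_integral_def by (intro nn_integral_cong) (simp add: u)
  also have "\<dots> = emeasure (density \<Omega> (\<lambda>x. ennreal (p x))) (space \<Omega>)"
    by (subst emeasure_density) (auto intro!: nn_integral_cong)
  also have "\<dots> = 1" using prob_space.emeasure_space_1[OF prob_p] by simp
  finally have Z1: "Z U x = 1" .
  thus "regular U x" by (simp add: regular_def)
  show "resample U x = density \<Omega> (\<lambda>x. ennreal (p x))"
  proof (rule measure_eqI)
    fix A assume "A \<in> sets (resample U x)"
    hence [measurable]: "A \<in> sets \<Omega>" by simp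
    have "emeasure (resample U x) A = (\<integral>\<^sup>+x'. indicator A x' \<partial>resample U x)" by simp
    also have "\<dots> = (\<integral>\<^sup>+w. ennreal (p w) * indicator A w \<partial>\<Omega>)"
      using assms nn_resample[of U x "indicator A"] unfolding Z1
      by (simp add: block_integral_def u divide_ennreal_def cong: nn_integral_cong)
    finally show "emeasure (resample U x) A = emeasure (density \<Omega> (\<lambda>x. ennreal (p x))) A"
      by (simp add: emeasure_density)
  qed simp
qed

end

section \<open>Norms of kernels\<close>

lemma nn_sq_int: "sq_int N f \<Longrightarrow> (\<integral>\<^sup>+x. ennreal ((f x)\<^sup>2) \<partial>N) = ennreal (\<integral>x. (f x)\<^sup>2 \<partial>N)"
  by (intro nn_integral_eq_integral) auto

lemma l2_norm_sq_int: "sq_int N f \<Longrightarrow> l2_norm N f = ennreal (sqrt (\<integral>x. (f x)\<^sup>2 \<partial>N))"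
  by (simp add: l2_norm_def nn_sq_int Let_def)

lemma l2_norm_cong: "AE x in N. f x = g x \<Longrightarrow> l2_norm N f = l2_norm N g"
proof -
  assume ae: "AE x in N. f x = g x"
  have "(\<integral>\<^sup>+x. ennreal ((f x)\<^sup>2) \<partial>N) = (\<integral>\<^sup>+x. ennreal ((g x)\<^sup>2) \<partial>N)"
    using ae by (intro nn_integral_cong_AE) auto
  thus ?thesis by (simp add: l2_norm_def)
qed

lemma L20_iff: "f \<in> L20 N \<longleftrightarrow> sq_int N f \<and> (\<integral>x. f x \<partial>N) = 0"
  by (auto simp: L20_def sq_int_def)

lemma kernel_norm_leI:
  assumes c: "c \<ge> 0"
    and *: "\<And>f. sq_int N f \<Longrightarrow> (\<integral>x. f x \<partial>N) = 0 \<Longrightarrow>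
      \<exists>g. sq_int N g \<and> (AE x in N. kernel_op K f x = g x) \<and> (\<integral>x. (g x)\<^sup>2 \<partial>N) \<le> c\<^sup>2 * (\<integral>x. (f x)\<^sup>2 \<partial>N)"
  shows "kernel_norm N K \<le> ennreal c"
  unfolding kernel_norm_def
proof (rule SUP_least)
  fix f assume "f \<in> {f \<in> L20 N. l2_norm N f \<noteq> 0}"
  hence f: "sq_int N f" "(\<integral>x. f x \<partial>N) = 0" "l2_norm N f \<noteq> 0" by (auto simp: L20_iff)
  from *[OF f(1,2)] obtain g where g: "sq_int N g" "AE x in N. kernel_op K f x = g x"
    "(\<integral>x. (g x)\<^sup>2 \<partial>N) \<le> c\<^sup>2 * (\<integral>x. (f x)\<^sup>2 \<partial>N)" by blast
  have "l2_norm N (kernel_op K f) = ennreal (sqrt (\<integral>x. (g x)\<^sup>2 \<partial>N))"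
    using l2_norm_cong[OF g(2)] l2_norm_sq_int[OF g(1)] by simp
  also have "\<dots> \<le> ennreal (sqrt (c\<^sup>2 * (\<integral>x. (f x)\<^sup>2 \<partial>N)))" using g(3) by (intro ennreal_leI) simp
  also have "\<dots> = ennreal c * l2_norm N f"
    using c by (simp add: l2_norm_sq_int[OF f(1)] real_sqrt_mult ennreal_mult)
  finally show "l2_norm N (kernel_op K f) / l2_norm N f \<le> ennreal c"
    using f(3) by (intro divide_le_posI_ennreal) (auto simp: zero_less_iff_neq_zero mult.commute)
qed

lemma kernel_norm_leD:
  assumes c: "c \<ge> 0" and le: "kernel_norm N K \<le> ennreal c"
    and f: "sq_int N f" "(\<integral>x. f x \<partial>N) = 0" "(\<integral>x. (f x)\<^sup>2 \<partial>N) > 0"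
    and g: "sq_int N g" "AE x in N. kernel_op K f x = g x"
  shows "(\<integral>x. (g x)\<^sup>2 \<partial>N) \<le> c\<^sup>2 * (\<integral>x. (f x)\<^sup>2 \<partial>N)"
proof -
  let ?f = "\<integral>x. (f x)\<^sup>2 \<partial>N" and ?g = "\<integral>x. (g x)\<^sup>2 \<partial>N"
  have "l2_norm N f \<noteq> 0" using f(3) by (simp add: l2_norm_sq_int[OF f(1)])
  hence "l2_norm N (kernel_op K f) / l2_norm N f \<le> ennreal c"
    using f by (intro order_trans[OF _ le]) (auto simp: kernel_norm_def L20_iff intro!: SUP_upper)
  also have "l2_norm N (kernel_op K f) / l2_norm N f = ennreal (sqrt ?g / sqrt ?f)"
    using f(3) by (simp add: l2_norm_cong[OF g(2)] l2_norm_sq_int f(1) g(1) divide_ennreal)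
  finally have "sqrt ?g / sqrt ?f \<le> c" using c by (simp add: ennreal_le_iff)
  hence "sqrt ?g \<le> c * sqrt ?f" using f(3) by (simp add: divide_le_eq)
  hence "(sqrt ?g)\<^sup>2 \<le> (c * sqrt ?f)\<^sup>2" by (intro power_mono) auto
  thus ?thesis using f(3) by (simp add: power_mult_distrib)
qed

section \<open>Uniform mixtures\<close>

text \<open>
  The average of finitely many subprobability measures, written as a monadic bind over the uniform
  distribution on \<open>S\<close>.
\<close>

locale uniform_mixture =
  fixes S :: "'i set" and B :: "'b measure" and N :: "'i \<Rightarrow> 'b measure"
  assumes S: "finite S" "S \<noteq> {}" and N: "\<And>s. s \<in> S \<Longrightarrow> N s \<in> space (subprob_algebra B)"
begin

abbreviation mix :: "'b measure" where "mix \<equiv> uniform_count_measure S \<bind> N"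

lemma N_meas: "N \<in> uniform_count_measure S \<rightarrow>\<^sub>M subprob_algebra B"
  using N by (auto simp: measurable_def space_uniform_count_measure sets_uniform_count_measure)

lemma sets_mix: "sets mix = sets B"
  using S N by (intro sets_bind) (auto simp: space_uniform_count_measure space_subprob_algebra)

lemma meas_mix: "measurable mix L = measurable B L" by (intro measurable_cong_sets sets_mix refl)

lemma meas_N: "s \<in> S \<Longrightarrow> measurable (N s) L = measurable B L"
  using N by (intro measurable_cong_sets) (auto simp: space_subprob_algebra)

lemma nn_mix:
  assumes "u \<in> borel_measurable B"
  shows "(\<integral>\<^sup>+z. u z \<partial>mix) = (\<Sum>s\<in>S. \<integral>\<^sup>+z. u z \<partial>N s) / ennreal (card S)"
proof -
  have c: "real (card S) > 0" using S by (simp add: card_gt_0_iff)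
  have "(\<integral>\<^sup>+z. u z \<partial>mix) = (\<integral>\<^sup>+s. \<integral>\<^sup>+z. u z \<partial>N s \<partial>uniform_count_measure S)"
    by (rule nn_integral_bind[OF assms N_meas])
  also have "\<dots> = (\<Sum>s\<in>S. ennreal (1 / card S) * (\<integral>\<^sup>+z. u z \<partial>N s))"
    unfolding uniform_count_measure_def using S by (subst nn_integral_point_measure_finite) auto
  also have "\<dots> = (\<Sum>s\<in>S. \<integral>\<^sup>+z. u z \<partial>N s) / ennreal (card S)"
    using c unfolding sum_distrib_left[symmetric]
    by (simp add: divide_ennreal_def inverse_ennreal mult.commute inverse_eq_divide)
  finally show ?thesis .
qed

lemma mix_nonneg:
  fixes f :: "'b \<Rightarrow> real"
  assumes m: "f \<in> borel_measurable B" and nn: "\<And>z. 0 \<le> f z" and i: "\<And>s. s \<in> S \<Longrightarrow> integrable (N s) f"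
  shows "integrable mix f" "(\<integral>z. f z \<partial>mix) = (\<Sum>s\<in>S. \<integral>z. f z \<partial>N s) / card S"
proof -
  have c: "real (card S) > 0" using S by (simp add: card_gt_0_iff)
  have e: "(\<integral>\<^sup>+z. f z \<partial>mix) = ennreal ((\<Sum>s\<in>S. \<integral>z. f z \<partial>N s) / card S)"
    using m c i by (subst nn_mix) (auto simp: nn_integral_eq_integral nn sum_nonneg divide_ennreal)
  show "integrable mix f"
    using e m by (intro integrableI_nn_integral_finite) (auto simp: nn meas_mix)
  have "0 \<le> (\<Sum>s\<in>S. \<integral>z. f z \<partial>N s) / card S" by (intro divide_nonneg_nonneg sum_nonneg) (auto simp: nn)
  thus "(\<integral>z. f z \<partial>mix) = (\<Sum>s\<in>S. \<integral>z. f z \<partial>N s) / card S"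
    using e m by (subst integral_eq_nn_integral) (auto simp: nn meas_mix)
qed

lemma mix_integral:
  fixes f :: "'b \<Rightarrow> real"
  assumes m: "f \<in> borel_measurable B" and i: "\<And>s. s \<in> S \<Longrightarrow> integrable (N s) f"
  shows "integrable mix f" "(\<integral>z. f z \<partial>mix) = (\<Sum>s\<in>S. \<integral>z. f z \<partial>N s) / card S"
proof -
  let ?p = "\<lambda>z. max 0 (f z)" and ?m = "\<lambda>z. max 0 (- f z)"
  have p: "?p \<in> borel_measurable B" "\<And>s. s \<in> S \<Longrightarrow> integrable (N s) ?p" using m i by auto
  have q: "?m \<in> borel_measurable B" "\<And>s. s \<in> S \<Longrightarrow> integrable (N s) ?m" using m i by auto
  note P = mix_nonneg[OF p(1) _ p(2)] and Q = mix_nonneg[OF q(1) _ q(2)]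
  have s: "f = (\<lambda>z. ?p z - ?m z)" by auto
  have ii: "integrable mix (\<lambda>z. ?p z - ?m z)" using P(1) Q(1) by (intro Bochner_Integration.integrable_diff) auto
  thus "integrable mix f" by (simp flip: s)
  have "(\<integral>z. f z \<partial>mix) = (\<integral>z. ?p z - ?m z \<partial>mix)" by (simp flip: s)
  also have "\<dots> = (\<integral>z. ?p z \<partial>mix) - (\<integral>z. ?m z \<partial>mix)"
    using P(1) Q(1) by (intro Bochner_Integration.integral_diff) auto
  also have "\<dots> = (\<Sum>s\<in>S. (\<integral>z. ?p z \<partial>N s) - (\<integral>z. ?m z \<partial>N s)) / card S"
    using P(2) Q(2) by (simp add: sum_subtractf diff_divide_distrib)
  also have "(\<Sum>s\<in>S. (\<integral>z. ?p z \<partial>N s) - (\<integral>z. ?m z \<partial>N s)) = (\<Sum>s\<in>S. \<integral>z. f z \<partial>N s)"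
  proof (rule sum.cong[OF refl])
    fix s' assume "s' \<in> S"
    hence "(\<integral>z. ?p z \<partial>N s') - (\<integral>z. ?m z \<partial>N s') = (\<integral>z. ?p z - ?m z \<partial>N s')"
      using p q by (intro Bochner_Integration.integral_diff[symmetric]) auto
    thus "(\<integral>z. ?p z \<partial>N s') - (\<integral>z. ?m z \<partial>N s') = (\<integral>z. f z \<partial>N s')" by (simp flip: s)
  qed
  finally show "(\<integral>z. f z \<partial>mix) = (\<Sum>s\<in>S. \<integral>z. f z \<partial>N s) / card S" .
qed

lemma mix_integrableD:
  fixes f :: "'b \<Rightarrow> real"
  assumes i: "integrable mix f" and s: "s \<in> S" shows "integrable (N s) f"
proof -
  have m: "f \<in> borel_measurable B" using i by (auto simp: meas_mix)
  have "(\<Sum>s\<in>S. \<integral>\<^sup>+z. norm (f z) \<partial>N s) / ennreal (card S) < \<infinity>"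
    using i m by (subst nn_mix[symmetric]) (auto simp: integrable_iff_bounded)
  hence "(\<Sum>s\<in>S. \<integral>\<^sup>+z. norm (f z) \<partial>N s) < \<infinity>"
    using S by (auto simp: ennreal_divide_eq_top_iff less_top[symmetric] ennreal_of_nat_eq_real_of_nat)
  hence "(\<integral>\<^sup>+z. norm (f z) \<partial>N s) < \<infinity>" using s S(1) by (simp add: less_top)
  thus ?thesis using m s by (simp add: integrable_iff_bounded meas_N)
qed

lemma mix_AE:
  assumes P: "{z \<in> space B. P z} \<in> sets B" and ae: "\<And>s. s \<in> S \<Longrightarrow> AE z in N s. P z"
  shows "AE z in mix. P z"
proof -
  have nP: "{z \<in> space B. \<not> P z} \<in> sets B" using sets.compl_sets[OF P] by (simp add: set_diff_eq conj_commute cong: conj_cong)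
  have sp: "space (N s) = space B" if "s \<in> S" for s
    using N[OF that] by (auto simp: space_subprob_algebra dest: sets_eq_imp_space_eq)
  have st: "sets (N s) = sets B" if "s \<in> S" for s using N[OF that] by (auto simp: space_subprob_algebra)
  have "emeasure mix {z \<in> space B. \<not> P z} = (\<integral>\<^sup>+z. indicator {z \<in> space B. \<not> P z} z \<partial>mix)"
    using nP by (simp add: sets_mix)
  also have "\<dots> = (\<Sum>s\<in>S. \<integral>\<^sup>+z. indicator {z \<in> space B. \<not> P z} z \<partial>N s) / ennreal (card S)"
    using nP by (intro nn_mix) simp
  also have "(\<Sum>s\<in>S. \<integral>\<^sup>+z. indicator {z \<in> space B. \<not> P z} z \<partial>N s) = 0"
  proof (rule sum.neutral, rule)
    fix s assume s: "s \<in> S"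
    have "(\<integral>\<^sup>+z. indicator {z \<in> space B. \<not> P z} z \<partial>N s) = emeasure (N s) {z \<in> space (N s). \<not> P z}"
      using nP s by (subst nn_integral_indicator) (auto simp: sp st)
    also have "\<dots> = 0" using ae[OF s] AE_iff_measurable[of "{z \<in> space (N s). \<not> P z}" "N s" P] nP s
      by (simp add: sp st)
    finally show "(\<integral>\<^sup>+z. indicator {z \<in> space B. \<not> P z} z \<partial>N s) = 0" .
  qed
  finally have "emeasure mix {z \<in> space B. \<not> P z} = 0" by simp
  thus ?thesis using nP by (intro AE_I[of _ _ "{z \<in> space B. \<not> P z}"])
    (auto simp: sets_mix sets_eq_imp_space_eq[OF sets_mix])
qed

end

lemma bind_uniform_cong:
  assumes "\<And>s. s \<in> S \<Longrightarrow> N s = N' s" "S \<noteq> {}"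
  shows "uniform_count_measure S \<bind> N = uniform_count_measure S \<bind> N'"
  using assms by (intro bind_cong_simp) (auto simp: space_uniform_count_measure simp_implies_def)

section \<open>The disjoint union of the coordinate spaces\<close>

lemma space_walk_space: "space (walk_space I M) = (SIGMA i:I. space (M i))"
  unfolding walk_space_def by (rule space_measure_of) (auto dest: sets.sets_into_space)

lemma sets_walk_space:
  "sets (walk_space I M) = sigma_sets (SIGMA i:I. space (M i)) {{i} \<times> A | i A. i \<in> I \<and> A \<in> sets (M i)}"
  unfolding walk_space_def by (rule sets_measure_of) (auto dest: sets.sets_into_space)

lemma measurable_to_walk_space:
  assumes "i \<in> I" "f \<in> L \<rightarrow>\<^sub>M M i" shows "(\<lambda>x. (i, f x)) \<in> L \<rightarrow>\<^sub>M walk_space I M"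
  unfolding walk_space_def
proof (rule measurable_measure_of)
  fix B assume "B \<in> {{i} \<times> A | i A. i \<in> I \<and> A \<in> sets (M i)}"
  then obtain j A where B: "B = {j} \<times> A" "A \<in> sets (M j)" by auto
  have "(\<lambda>x. (i, f x)) -` B \<inter> space L = (if i = j then f -` A \<inter> space L else {})"
    using B by auto
  thus "(\<lambda>x. (i, f x)) -` B \<inter> space L \<in> sets L"
    using B measurable_sets[OF assms(2)] by auto
qed (use assms measurable_space[OF assms(2)] in \<open>auto dest: sets.sets_into_space\<close>)

lemma measurable_from_walk_space:
  assumes "finite I" "\<And>i. i \<in> I \<Longrightarrow> (\<lambda>a. h (i, a)) \<in> M i \<rightarrow>\<^sub>M L"
  shows "h \<in> walk_space I M \<rightarrow>\<^sub>M L"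
proof (rule measurableI)
  fix z assume "z \<in> space (walk_space I M)" thus "h z \<in> space L"
    using measurable_space[OF assms(2)] by (auto simp: space_walk_space)
next
  fix B assume B: "B \<in> sets L"
  have "h -` B \<inter> space (walk_space I M) = (\<Union>i\<in>I. {i} \<times> ((\<lambda>a. h (i, a)) -` B \<inter> space (M i)))"
    by (auto simp: space_walk_space)
  also have "\<dots> \<in> sets (walk_space I M)"
    using measurable_sets[OF assms(2) B] assms(1)
    by (intro sets.finite_UN) (auto simp: sets_walk_space intro!: sigma_sets.Basic)
  finally show "h -` B \<inter> space (walk_space I M) \<in> sets (walk_space I M)" .
qed

section \<open>The random walk on a fibre\<close>

text \<open>
  A fibre is the set of configurations that agree with \<open>x0\<close> outside \<open>I\<close>.  Its conditional distribution
  \<open>N\<close> is kept on the full product, so that all blocks inside \<open>I\<close> act on the same space.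
\<close>

locale fibre = joint_density U n M p
  for U :: "nat set" and n :: nat and M :: "nat \<Rightarrow> 'a measure" and p :: "(nat \<Rightarrow> 'a) \<Rightarrow> real" +
  fixes q :: "'a cond_family" and I :: "nat set" and x0 :: "nat \<Rightarrow> 'a"
  assumes I_sub: "I \<subseteq> U" and I_ne: "I \<noteq> {}" and x0: "x0 \<in> space \<Omega>" and regular_x0: "regular I x0"
begin

abbreviation N :: "(nat \<Rightarrow> 'a) measure" where "N \<equiv> resample I x0"
abbreviation \<Lambda> :: "nat set" where "\<Lambda> \<equiv> U - I"
abbreviation y :: "nat \<Rightarrow> 'a" where "y \<equiv> restrict x0 \<Lambda>"

sublocale prob_space N by (rule prob_resample[OF I_sub x0 regular_x0])

lemma fin_I: "finite I" using fin_sub[OF I_sub] .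
lemma card_I: "card I > 0" using fin_I I_ne by (simp add: card_gt_0_iff)

lemma cond_kernel_block: "\<Gamma> \<subseteq> I \<Longrightarrow> cond_kernel N (resample \<Gamma>)"
  by (rule cond_kernel_resample[OF _ I_sub x0 regular_x0])

lemma AE_restrict: "AE x in N. x \<in> space \<Omega> \<and> restrict x \<Lambda> = restrict x0 \<Lambda>"
  using AE_resample_restrict[OF I_sub x0] AE_space by eventually_elim simp

lemma AE_regular_block: "\<Gamma> \<subseteq> I \<Longrightarrow> AE x in N. regular \<Gamma> x"
  by (rule AE_regular[OF _ I_sub x0 regular_x0])

lemma regular_meas: "\<Gamma> \<subseteq> U \<Longrightarrow> {x \<in> space \<Omega>. regular \<Gamma> x} \<in> sets \<Omega>"
proof -
  assume "\<Gamma> \<subseteq> U"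
  note [measurable] = block_integral_meas[OF this]
  show ?thesis unfolding regular_def by measurable
qed

lemma integrable_resample_meas:
  fixes f :: "(nat \<Rightarrow> 'a) \<Rightarrow> real"
  assumes "\<Gamma> \<subseteq> U" "f \<in> borel_measurable \<Omega>"
  shows "{x \<in> space \<Omega>. integrable (resample \<Gamma> x) f} \<in> sets \<Omega>"
  using measurable_compose[OF resample_meas[OF assms(1)] integrable_measurable_subprob_algebra[OF assms(2)]]
  by (simp add: pred_def)

lemma kernel_op_resample_meas:
  assumes "\<Gamma> \<subseteq> U" "f \<in> borel_measurable \<Omega>"
  shows "kernel_op (resample \<Gamma>) f \<in> borel_measurable \<Omega>"
  unfolding kernel_op_def[abs_def]
  by (rule measurable_compose[OF resample_meas[OF assms(1)] integral_measurable_subprob_algebra[OF assms(2)]])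

lemma coord_meas: "i \<in> I \<Longrightarrow> (\<lambda>x. x i) \<in> \<Omega> \<rightarrow>\<^sub>M M i"
  using I_sub by (intro measurable_component_singleton) auto

lemma pair_meas: "i \<in> I \<Longrightarrow> (\<lambda>x. (i, x i)) \<in> \<Omega> \<rightarrow>\<^sub>M walk_space I M"
  by (intro measurable_to_walk_space coord_meas)

text \<open>
  The kernel and the stationary distribution of the walk, and the kernel \<open>KW j\<close> that redraws all
  coordinates in \<open>I\<close> except \<open>j\<close>.
\<close>

abbreviation W :: "nat \<times> 'a \<Rightarrow> (nat \<times> 'a) measure" where "W \<equiv> walk_kernel n M p q \<Lambda> y"
abbreviation \<phi> :: "(nat \<times> 'a) measure" where "\<phi> \<equiv> walk_stationary n M p q \<Lambda> y"

text \<open>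
  A state \<open>(j, a)\<close> of the walk as a configuration of the fibre: \<open>a\<close> at \<open>j\<close>.  The remaining
  coordinates in \<open>I\<close> are those of \<open>x0\<close>, and are irrelevant as they are always redrawn.
\<close>

definition emb :: "nat \<Rightarrow> 'a \<Rightarrow> nat \<Rightarrow> 'a" where "emb j a = x0(j := a)"

text \<open>
  The averaging map from functions on the state space of the walk to functions on the fibre.  Its
  adjoint sends \<open>F\<close> to the function \<open>(j, x j) \<mapsto> E(F | x j)\<close>.
\<close>

definition avg :: "(nat \<times> 'a \<Rightarrow> real) \<Rightarrow> (nat \<Rightarrow> 'a) \<Rightarrow> real" where
  "avg h x = (\<Sum>i\<in>I. h (i, x i)) / card I"

abbreviation KW :: "nat \<Rightarrow> (nat \<Rightarrow> 'a) \<Rightarrow> (nat \<Rightarrow> 'a) measure" where "KW j \<equiv> resample (I - {j})"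

lemma Un_block: "j \<in> I \<Longrightarrow> U - (I - {j}) = \<Lambda> \<union> {j}" using I_sub by auto

lemma emb_meas: "j \<in> I \<Longrightarrow> emb j \<in> M j \<rightarrow>\<^sub>M \<Omega>"
  unfolding emb_def[abs_def] using I_sub x0 by (intro measurable_fun_upd[of U U]) auto

lemma emb_space: "j \<in> I \<Longrightarrow> a \<in> space (M j) \<Longrightarrow> emb j a \<in> space \<Omega>"
  using measurable_space[OF emb_meas] .

lemma emb_restrict:
  assumes "j \<in> I" "restrict x \<Lambda> = restrict x0 \<Lambda>"
  shows "restrict (emb j (x j)) (U - (I - {j})) = restrict x (U - (I - {j}))"
proof
  fix i
  have "x i = x0 i" if "i \<in> \<Lambda>" using fun_cong[OF assms(2), of i] that by simp
  thus "restrict (emb j (x j)) (U - (I - {j})) i = restrict x (U - (I - {j})) i"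
    using assms(1) unfolding Un_block[OF assms(1)] by (auto simp: emb_def restrict_def)
qed

lemma UmU: "{1..n} - \<Lambda> = I" using I_sub U_eq by auto

lemma stationary_eq:
  "\<phi> = uniform_count_measure I \<bind> (\<lambda>i. distr N (walk_space I M) (\<lambda>x. (i, x i)))"
  unfolding walk_stationary_def UmU
proof (rule bind_uniform_cong[OF _ I_ne])
  fix i assume i: "i \<in> I"
  have [measurable]: "(\<lambda>x. restrict x {i}) \<in> \<Omega> \<rightarrow>\<^sub>M Pi\<^sub>M {i} M"
    using i I_sub by (intro measurable_restrict_subset) auto
  have [measurable]: "(\<lambda>w. (i, w i)) \<in> Pi\<^sub>M {i} M \<rightarrow>\<^sub>M walk_space I M"
    using i by (intro measurable_to_walk_space measurable_component_singleton) auto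
  show "distr (cond_dist n M p q {i} \<Lambda> y) (walk_space I M) (\<lambda>w. (i, w i)) =
        distr N (walk_space I M) (\<lambda>x. (i, x i))"
    using i by (subst cond_dist_resample[OF _ I_sub x0 regular_x0]) (auto simp: distr_distr comp_def)
qed

lemma distr_pair_subprob:
  assumes "i \<in> I" "\<Gamma> \<subseteq> U" "x \<in> space \<Omega>"
  shows "distr (resample \<Gamma> x) (walk_space I M) (\<lambda>x. (i, x i)) \<in> space (subprob_algebra (walk_space I M))"
proof -
  have "resample \<Gamma> x \<in> space (subprob_algebra \<Omega>)" using measurable_space[OF resample_meas] assms by blast
  thus ?thesis using measurable_space[OF measurable_distr[OF pair_meas[OF assms(1)]]] by blast
qed

text \<open>
  The holding move of the walk is a redraw as well: \<open>KW j\<close> keeps the coordinate \<open>j\<close>, so the \<open>j\<close>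
  coordinate of the redrawn configuration is \<open>a\<close> almost surely.  All moves then have the same form.
\<close>

lemma walk_kernel_eq:
  assumes j: "j \<in> I" and a: "a \<in> space (M j)" and g: "regular (I - {j}) (emb j a)"
  shows "W (j, a) = uniform_count_measure I \<bind> (\<lambda>i. distr (KW j (emb j a)) (walk_space I M) (\<lambda>x. (i, x i)))"
proof -
  have sub: "I - {j} \<subseteq> U" using I_sub by auto
  note e = emb_space[OF j a]
  show ?thesis
    unfolding walk_kernel_def UmU prod.case
  proof (rule bind_uniform_cong[OF _ I_ne])
    fix i assume i: "i \<in> I"
    note [measurable] = pair_meas[OF i]
    show "(if i = j then return (walk_space I M) (j, a)
        else distr (cond_dist n M p q {i} (\<Lambda> \<union> {j}) (merge \<Lambda> {j} (y, \<lambda>_. a))) (walk_space I M) (\<lambda>w. (i, w i))) =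
        distr (KW j (emb j a)) (walk_space I M) (\<lambda>x. (i, x i))"
    proof (cases "i = j")
      case True
      interpret KJ: prob_space "KW j (emb j a)" by (rule prob_resample[OF sub e g])
      have "AE x in KW j (emb j a). restrict x (U - (I - {j})) = restrict (emb j a) (U - (I - {j}))"
        by (rule AE_resample_restrict[OF sub e])
      hence "AE x in KW j (emb j a). (i, x i) = (j, a)"
      proof eventually_elim
        case (elim x)
        from fun_cong[OF elim, of j] show ?case using True j I_sub by (auto simp: emb_def)
      qed
      hence "distr (KW j (emb j a)) (walk_space I M) (\<lambda>x. (i, x i)) = distr (KW j (emb j a)) (walk_space I M) (\<lambda>_. (j, a))"
        using j a pair_meas[OF i] pair_meas[OF j] by (intro distr_cong_AE) (auto simp: space_walk_space)
      also have "\<dots> = return (walk_space I M) (j, a)"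
        using j a by (intro KJ.distr_const) (auto simp: space_walk_space)
      finally show ?thesis using True by simp
    next
      case False
      have [measurable]: "(\<lambda>x. restrict x {i}) \<in> \<Omega> \<rightarrow>\<^sub>M Pi\<^sub>M {i} M"
        using i I_sub by (intro measurable_restrict_subset) auto
      have [measurable]: "(\<lambda>w. (i, w i)) \<in> Pi\<^sub>M {i} M \<rightarrow>\<^sub>M walk_space I M"
        using i by (intro measurable_to_walk_space measurable_component_singleton) auto
      have "merge \<Lambda> {j} (y, \<lambda>_. a) = restrict (emb j a) (U - (I - {j}))"
        unfolding Un_block[OF j] using j by (auto simp: fun_eq_iff merge_def emb_def)
      hence "cond_dist n M p q {i} (\<Lambda> \<union> {j}) (merge \<Lambda> {j} (y, \<lambda>_. a)) =
          distr (KW j (emb j a)) (Pi\<^sub>M {i} M) (\<lambda>x. restrict x {i})"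
        using cond_dist_resample[OF _ sub e g, of "{i}" q] i False unfolding Un_block[OF j] by auto
      thus ?thesis using False by (simp add: distr_distr comp_def)
    qed
  qed
qed

sublocale mixW: uniform_mixture I "walk_space I M" "\<lambda>i. distr N (walk_space I M) (\<lambda>x. (i, x i))"
  by unfold_locales (auto simp: fin_I I_ne intro: distr_pair_subprob[OF _ I_sub x0])

lemma meas_stationary: "measurable \<phi> L = measurable (walk_space I M) L"
  unfolding stationary_eq by (rule mixW.meas_mix)

lemma integrable_stationary_iff:
  fixes h :: "nat \<times> 'a \<Rightarrow> real"
  assumes "h \<in> borel_measurable (walk_space I M)"
  shows "integrable \<phi> h \<longleftrightarrow> (\<forall>i\<in>I. integrable N (\<lambda>x. h (i, x i)))"
proof -
  have "integrable (distr N (walk_space I M) (\<lambda>x. (i, x i))) h \<longleftrightarrow> integrable N (\<lambda>x. h (i, x i))" if "i \<in> I" for i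
    using pair_meas[OF that] assms by (subst integrable_distr_eq) auto
  thus ?thesis unfolding stationary_eq using mixW.mix_integral(1)[OF assms] mixW.mix_integrableD[of h] by auto
qed

lemma integral_stationary:
  fixes h :: "nat \<times> 'a \<Rightarrow> real"
  assumes h: "integrable \<phi> h"
  shows "(\<integral>z. h z \<partial>\<phi>) = (\<Sum>i\<in>I. \<integral>x. h (i, x i) \<partial>N) / card I"
proof -
  have m: "h \<in> borel_measurable (walk_space I M)" using h by (auto simp flip: meas_stationary)
  have d: "integral\<^sup>L (distr N (walk_space I M) (\<lambda>x. (i, x i))) h = (\<integral>x. h (i, x i) \<partial>N)" if "i \<in> I" for i
    using pair_meas[OF that] m by (subst integral_distr) auto
  have "integral\<^sup>L \<phi> h = (\<Sum>i\<in>I. integral\<^sup>L (distr N (walk_space I M) (\<lambda>x. (i, x i))) h) / card I"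
    using h mixW.mix_integral(2)[OF m] mixW.mix_integrableD[of h] unfolding stationary_eq by auto
  thus ?thesis by (simp add: d)
qed

lemma sq_int_stationary_iff:
  assumes "h \<in> borel_measurable (walk_space I M)"
  shows "sq_int \<phi> h \<longleftrightarrow> (\<forall>i\<in>I. sq_int N (\<lambda>x. h (i, x i)))"
proof -
  have "(\<lambda>x. h (i, x i)) \<in> borel_measurable \<Omega>" if "i \<in> I" for i
    using measurable_compose[OF pair_meas[OF that] assms] .
  thus ?thesis using assms integrable_stationary_iff[of "\<lambda>z. (h z)\<^sup>2"]
    by (auto simp: sq_int_def meas_stationary)
qed

lemma sq_int_stationaryD:
  assumes h: "sq_int \<phi> h"
  shows "h \<in> borel_measurable (walk_space I M)" "i \<in> I \<Longrightarrow> sq_int N (\<lambda>x. h (i, x i))"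
    "(\<integral>z. (h z)\<^sup>2 \<partial>\<phi>) = (\<Sum>i\<in>I. \<integral>x. (h (i, x i))\<^sup>2 \<partial>N) / card I" "sq_int N (avg h)"
proof -
  show m: "h \<in> borel_measurable (walk_space I M)" using h by (auto simp flip: meas_stationary)
  show s: "i \<in> I \<Longrightarrow> sq_int N (\<lambda>x. h (i, x i))" for i using sq_int_stationary_iff[OF m] h by auto
  show "(\<integral>z. (h z)\<^sup>2 \<partial>\<phi>) = (\<Sum>i\<in>I. \<integral>x. (h (i, x i))\<^sup>2 \<partial>N) / card I"
    using h by (intro integral_stationary) auto
  show "sq_int N (avg h)" unfolding avg_def[abs_def] by (intro sq_int_divide sq_int_sum s)
qed

text \<open>
  The operator of the walk, as the averaging map followed by its adjoint.  It is measurable, and agrees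
  almost everywhere with \<open>kernel_op W\<close> on square-integrable functions.
\<close>

definition walk_op :: "(nat \<times> 'a \<Rightarrow> real) \<Rightarrow> nat \<times> 'a \<Rightarrow> real" where
  "walk_op h = (\<lambda>(j, a). kernel_op (KW j) (avg h) (emb j a))"

text \<open>
  In terms of a random configuration of the fibre, \<open>walk_op h\<close> is the conditional expectation of \<open>avg h\<close>
  given the coordinate \<open>j\<close>.
\<close>

lemma walk_op_coord:
  assumes "j \<in> I" shows "AE x in N. walk_op h (j, x j) = kernel_op (KW j) (avg h) x"
  using AE_restrict
  by eventually_elim (simp add: walk_op_def kernel_op_def resample_cong[OF emb_restrict[OF assms]])

lemma avg_meas:
  assumes "h \<in> borel_measurable (walk_space I M)" shows "avg h \<in> borel_measurable \<Omega>"
  unfolding avg_def[abs_def]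
  by (intro borel_measurable_divide borel_measurable_sum measurable_compose[OF pair_meas assms]) auto

lemma walk_op_meas:
  assumes "h \<in> borel_measurable (walk_space I M)" shows "walk_op h \<in> borel_measurable (walk_space I M)"
proof (rule measurable_from_walk_space[OF fin_I])
  fix j assume j: "j \<in> I"
  have "I - {j} \<subseteq> U" using I_sub by auto
  from measurable_compose[OF emb_meas[OF j] kernel_op_resample_meas[OF this avg_meas[OF assms]]]
  show "(\<lambda>a. walk_op h (j, a)) \<in> M j \<rightarrow>\<^sub>M borel" by (simp add: walk_op_def)
qed

lemma walk_op_sq_int:
  assumes h: "sq_int \<phi> h"
  shows "sq_int \<phi> (walk_op h)"
    and "(\<integral>z. (walk_op h z)\<^sup>2 \<partial>\<phi>) = (\<Sum>j\<in>I. \<integral>x. (kernel_op (KW j) (avg h) x)\<^sup>2 \<partial>N) / card I"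
proof -
  note H = sq_int_stationaryD[OF h]
  have s: "sq_int N (kernel_op (KW j) (avg h))" for j
    by (intro cond_kernel.E_sq_int cond_kernel_block H) auto
  have m: "walk_op h \<in> borel_measurable (walk_space I M)" by (rule walk_op_meas[OF H(1)])
  have mj: "(\<lambda>x. walk_op h (j, x j)) \<in> borel_measurable N" if "j \<in> I" for j
    using measurable_compose[OF pair_meas[OF that] m] by simp
  show w: "sq_int \<phi> (walk_op h)"
    unfolding sq_int_stationary_iff[OF m]
  proof
    fix j assume j: "j \<in> I"
    show "sq_int N (\<lambda>x. walk_op h (j, x j))"
      using walk_op_coord[OF j, of h] by (intro sq_int_cong_AE[OF s mj[OF j]]) auto
  qed
  have "(\<integral>x. (walk_op h (j, x j))\<^sup>2 \<partial>N) = (\<integral>x. (kernel_op (KW j) (avg h) x)\<^sup>2 \<partial>N)" if "j \<in> I" for j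
    using walk_op_coord[OF that, of h] mj[OF that] s[of j]
    by (intro integral_cong_AE) (auto simp: sq_int_def)
  thus "(\<integral>z. (walk_op h z)\<^sup>2 \<partial>\<phi>) = (\<Sum>j\<in>I. \<integral>x. (kernel_op (KW j) (avg h) x)\<^sup>2 \<partial>N) / card I"
    using sq_int_stationaryD(3)[OF w] by simp
qed

lemma walk_op_AE:
  assumes h: "sq_int \<phi> h"
  shows "AE z in \<phi>. kernel_op W h z = walk_op h z"
proof -
  note H = sq_int_stationaryD[OF h]
  have hm: "(\<lambda>x. h (i, x i)) \<in> borel_measurable \<Omega>" if "i \<in> I" for i
    using measurable_compose[OF pair_meas[OF that] H(1)] .
  define G where "G j x \<longleftrightarrow> regular (I - {j}) x \<and> (\<forall>i\<in>I. integrable (KW j x) (\<lambda>x. h (i, x i)))" for j x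
  have G_meas: "{x \<in> space \<Omega>. G j x} \<in> sets \<Omega>" for j
    unfolding G_def using I_sub fin_I
    by (intro sets.sets_Collect_conj sets.sets_Collect_finite_All regular_meas integrable_resample_meas hm) auto
  have G_cong: "G j x = G j x'" if "restrict x (U - (I - {j})) = restrict x' (U - (I - {j}))" for j x x'
    using regular_cong[OF that] resample_cong[OF that] by (simp add: G_def)
  \<comment> \<open>The exceptional set is measurable in the disjoint union, and null because it is null in each coordinate.\<close>
  let ?P = "\<lambda>z. case z of (j, a) \<Rightarrow> G j (emb j a)"
  have "AE z in \<phi>. ?P z"
    unfolding stationary_eq
  proof (rule mixW.mix_AE)
    have "?P \<in> walk_space I M \<rightarrow>\<^sub>M count_space UNIV"
    proof (rule measurable_from_walk_space[OF fin_I])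
      fix j assume j: "j \<in> I"
      have "G j \<in> \<Omega> \<rightarrow>\<^sub>M count_space UNIV" using G_meas by (simp add: pred_def)
      from measurable_compose[OF emb_meas[OF j] this]
      show "(\<lambda>a. ?P (j, a)) \<in> M j \<rightarrow>\<^sub>M count_space UNIV" by simp
    qed
    thus P: "{z \<in> space (walk_space I M). ?P z} \<in> sets (walk_space I M)" by (simp add: pred_def)
    fix j assume j: "j \<in> I"
    have "integrable N (\<lambda>x. h (i, x i))" if "i \<in> I" for i using sq_int_integrable[OF H(2)[OF that]] .
    hence "AE x in N. \<forall>i\<in>I. integrable (KW j x) (\<lambda>x. h (i, x i))"
      using fin_I by (intro AE_finite_allI) (auto intro!: cond_kernel.AE_integrable cond_kernel_block)
    hence "AE x in N. G j (emb j (x j))"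
      using AE_regular_block[OF Diff_subset, of "{j}"] AE_restrict
      by eventually_elim (rule iffD2[OF G_cong[OF emb_restrict[OF j]]], simp_all add: G_def)
    thus "AE z in distr N (walk_space I M) (\<lambda>x. (j, x j)). ?P z"
      using pair_meas[OF j] P by (subst AE_distr_iff) auto
  qed
  moreover have "AE z in \<phi>. z \<in> space (walk_space I M)"
    using sets_eq_imp_space_eq[OF mixW.sets_mix] by (intro AE_I2) (simp add: stationary_eq)
  ultimately show ?thesis
  proof eventually_elim
    fix z assume z: "?P z" "z \<in> space (walk_space I M)"
    obtain j a where za: "z = (j, a)" by (cases z)
    have j: "j \<in> I" and a: "a \<in> space (M j)" and g: "regular (I - {j}) (emb j a)"
      and i: "\<And>i. i \<in> I \<Longrightarrow> integrable (KW j (emb j a)) (\<lambda>x. h (i, x i))"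
      using z by (auto simp: za space_walk_space G_def)
    have sub: "I - {j} \<subseteq> U" using I_sub by auto
    note e = emb_space[OF j a]
    interpret mixj: uniform_mixture I "walk_space I M" "\<lambda>i. distr (KW j (emb j a)) (walk_space I M) (\<lambda>x. (i, x i))"
      by unfold_locales (auto simp: fin_I I_ne intro: distr_pair_subprob[OF _ sub e])
    have d: "integrable (distr (KW j (emb j a)) (walk_space I M) (\<lambda>x. (i, x i))) h"
      "(\<integral>z. h z \<partial>distr (KW j (emb j a)) (walk_space I M) (\<lambda>x. (i, x i))) = (\<integral>x. h (i, x i) \<partial>KW j (emb j a))"
      if "i \<in> I" for i
      using pair_meas[OF that] H(1) i[OF that] by (auto simp: integrable_distr_eq integral_distr)
    have "kernel_op W h z = (\<Sum>i\<in>I. \<integral>x. h (i, x i) \<partial>KW j (emb j a)) / card I"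
      unfolding za kernel_op_def walk_kernel_eq[OF j a g]
      using d by (subst mixj.mix_integral(2)[OF H(1)]) auto
    also have "\<dots> = walk_op h z" using i by (simp add: za walk_op_def kernel_op_def avg_def)
    finally show "kernel_op W h z = walk_op h z" .
  qed
qed

text \<open>
  Hence the gap of the walk is nonnegative, without which products of gaps could not be compared.
\<close>

lemma walk_norm_le_1: "kernel_norm \<phi> W \<le> 1"
proof -
  have "kernel_norm \<phi> W \<le> ennreal 1"
  proof (rule kernel_norm_leI)
    fix h assume h: "sq_int \<phi> h"
    note H = sq_int_stationaryD[OF h]
    have "(\<integral>z. (walk_op h z)\<^sup>2 \<partial>\<phi>) \<le> (\<Sum>j\<in>I. \<integral>x. (avg h x)\<^sup>2 \<partial>N) / card I"
      unfolding walk_op_sq_int(2)[OF h]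
      by (intro divide_right_mono sum_mono cond_kernel.E_contraction cond_kernel_block H) auto
    also have "\<dots> = (\<integral>x. (avg h x)\<^sup>2 \<partial>N)" using card_I by simp
    also have "\<dots> \<le> (\<integral>x. (\<Sum>i\<in>I. (h (i, x i))\<^sup>2) / card I \<partial>N)"
      using H(2,4) unfolding sq_int_def
      by (intro integral_mono) (auto simp: avg_def intro!: power2_average_le fin_I I_ne)
    also have "\<dots> = (\<integral>z. (h z)\<^sup>2 \<partial>\<phi>)"
      using H(2) unfolding H(3) by (simp add: sq_int_def)
    finally show "\<exists>g. sq_int \<phi> g \<and> (AE z in \<phi>. kernel_op W h z = g z) \<and>
        (\<integral>z. (g z)\<^sup>2 \<partial>\<phi>) \<le> 1\<^sup>2 * (\<integral>z. (h z)\<^sup>2 \<partial>\<phi>)"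
      using walk_op_sq_int(1)[OF h] walk_op_AE[OF h] by auto
  qed simp
  thus ?thesis by simp
qed

text \<open>
  The comparison of the walk with the sampler that keeps one coordinate.  Let \<open>T\<close> be \<open>avg\<close>, let \<open>T*\<close> be
  its adjoint, and \<open>h = T* F\<close>.  Then \<open>P F = T h\<close> is the sampler and \<open>T* T\<close> the walk, and the left-hand
  side \<open>A\<close> is both the squared norm of \<open>h\<close> and the inner product of \<open>F\<close> and \<open>P F\<close>.  The squared norm
  \<open>B\<close> of \<open>P F\<close> is the inner product of \<open>h\<close> and \<open>T* T h\<close>, at most \<open>w A\<close>; and \<open>A\<close> is at most
  \<open>(w |F|^2 + B / w) / 2\<close>, whence the claim.
\<close>

lemma sum_E_sq_le_aux:
  assumes w: "w > 0" and le: "kernel_norm \<phi> W \<le> ennreal w"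
    and F: "sq_int N F" "(\<integral>x. F x \<partial>N) = 0"
  shows "(\<Sum>j\<in>I. \<integral>x. (kernel_op (KW j) F x)\<^sup>2 \<partial>N) / card I \<le> w * (\<integral>x. (F x)\<^sup>2 \<partial>N)"
proof -
  define A where "A = (\<Sum>j\<in>I. \<integral>x. (kernel_op (KW j) F x)\<^sup>2 \<partial>N) / card I"
  have K: "cond_kernel N (KW j)" for j by (rule cond_kernel_block) auto
  have EF: "sq_int N (kernel_op (KW j) F)" for j by (rule cond_kernel.E_sq_int[OF K F(1)])
  define h where "h = (\<lambda>(j, a). kernel_op (KW j) F (emb j a))"
  have Fm: "F \<in> borel_measurable \<Omega>" using F by (auto simp: sq_int_def)
  have hm: "h \<in> borel_measurable (walk_space I M)"
  proof (rule measurable_from_walk_space[OF fin_I])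
    fix j assume j: "j \<in> I"
    have "I - {j} \<subseteq> U" using I_sub by auto
    from measurable_compose[OF emb_meas[OF j] kernel_op_resample_meas[OF this Fm]]
    show "(\<lambda>a. h (j, a)) \<in> M j \<rightarrow>\<^sub>M borel" by (simp add: h_def)
  qed
  have hc: "AE x in N. kernel_op (KW j) F x = h (j, x j)" if "j \<in> I" for j
    using AE_restrict
    by eventually_elim (simp add: h_def kernel_op_def resample_cong[OF emb_restrict[OF that]])
  have hmN: "(\<lambda>x. h (j, x j)) \<in> borel_measurable N" if "j \<in> I" for j
    using measurable_compose[OF pair_meas[OF that] hm] by simp
  have h: "sq_int \<phi> h" unfolding sq_int_stationary_iff[OF hm]
    by (intro ballI sq_int_cong_AE[OF EF hmN hc])
  note H = sq_int_stationaryD[OF h]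
  have EFm: "kernel_op (KW j) F \<in> borel_measurable N" for j by (rule sq_intD(1)[OF EF])
  have hE: "(\<integral>x. h (j, x j) \<partial>N) = (\<integral>x. kernel_op (KW j) F x \<partial>N)"
    "(\<integral>x. (h (j, x j))\<^sup>2 \<partial>N) = (\<integral>x. (kernel_op (KW j) F x)\<^sup>2 \<partial>N)" if "j \<in> I" for j
  proof -
    show "(\<integral>x. h (j, x j) \<partial>N) = (\<integral>x. kernel_op (KW j) F x \<partial>N)"
      using hc[OF that] by (intro integral_cong_AE hmN[OF that] EFm) auto
    show "(\<integral>x. (h (j, x j))\<^sup>2 \<partial>N) = (\<integral>x. (kernel_op (KW j) F x)\<^sup>2 \<partial>N)"
      using hc[OF that] by (intro integral_cong_AE borel_measurable_power hmN[OF that] EFm) auto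
  qed
  have h2: "(\<integral>z. (h z)\<^sup>2 \<partial>\<phi>) = A" unfolding H(3) A_def by (simp add: hE)
  have "integrable \<phi> h"
    unfolding integrable_stationary_iff[OF hm] using sq_int_integrable[OF H(2)] by auto
  hence "(\<integral>z. h z \<partial>\<phi>) = (\<Sum>j\<in>I. \<integral>x. h (j, x j) \<partial>N) / card I" by (rule integral_stationary)
  also have "(\<Sum>j\<in>I. \<integral>x. h (j, x j) \<partial>N) = (\<Sum>j\<in>I. \<integral>x. kernel_op (KW j) F x \<partial>N)"
    by (simp add: hE)
  also have "\<dots> = 0"
    using cond_kernel.E_integral(2)[OF K sq_int_integrable[OF F(1)]] F(2) by simp
  finally have h0: "(\<integral>z. h z \<partial>\<phi>) = 0" by (simp only: div_0)
  define P where "P = (\<lambda>x. (\<Sum>j\<in>I. kernel_op (KW j) F x) / card I)"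
  have P: "sq_int N P"
    unfolding P_def by (rule average_projections_form(1)[OF fin_I I_ne K F(1) F(1)])
  have P_mult: "(\<integral>x. P x * g x \<partial>N) =
      (\<Sum>j\<in>I. \<integral>x. kernel_op (KW j) F x * kernel_op (KW j) g x \<partial>N) / card I" if "sq_int N g" for g
    unfolding P_def by (rule average_projections_form(2)[OF fin_I I_ne K F(1) that])
  have "AE x in N. \<forall>j\<in>I. kernel_op (KW j) F x = h (j, x j)"
    using fin_I hc by (intro AE_finite_allI) auto
  hence PS: "AE x in N. P x = avg h x" by eventually_elim (simp add: P_def avg_def)
  have KP: "AE x in N. kernel_op (KW j) P x = kernel_op (KW j) (avg h) x" for j
    using cond_kernel.AE_K[OF K PS, of j] AE_space
  proof eventually_elim
    case (elim x)
    have "P \<in> borel_measurable \<Omega>" "avg h \<in> borel_measurable \<Omega>"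
      using P avg_meas[OF hm] by (auto simp: sq_int_def)
    thus ?case unfolding kernel_op_def by (intro integral_cong_AE elim) auto
  qed
  have EP: "sq_int N (kernel_op (KW j) P)" for j by (rule cond_kernel.E_sq_int[OF K P])
  have ES: "sq_int N (kernel_op (KW j) (avg h))" for j by (rule cond_kernel.E_sq_int[OF K H(4)])
  have W2: "(\<Sum>j\<in>I. \<integral>x. (kernel_op (KW j) P x)\<^sup>2 \<partial>N) / card I \<le> w\<^sup>2 * A" if "A > 0"
  proof -
    have "(\<integral>x. (kernel_op (KW j) P x)\<^sup>2 \<partial>N) = (\<integral>x. (kernel_op (KW j) (avg h) x)\<^sup>2 \<partial>N)" for j
      using KP[of j] by (intro integral_cong_AE borel_measurable_power sq_intD(1)[OF EP] sq_intD(1)[OF ES]) auto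
    hence "(\<Sum>j\<in>I. \<integral>x. (kernel_op (KW j) P x)\<^sup>2 \<partial>N) / card I = (\<integral>z. (walk_op h z)\<^sup>2 \<partial>\<phi>)"
      unfolding walk_op_sq_int(2)[OF h] by simp
    also have "\<dots> \<le> w\<^sup>2 * A"
      using kernel_norm_leD[OF _ le h h0 _ walk_op_sq_int(1)[OF h] walk_op_AE[OF h]] w that by (simp add: h2)
    finally show ?thesis .
  qed
  define B where "B = (\<integral>x. (P x)\<^sup>2 \<partial>N)"
  have B: "B \<le> w * A" if A: "A > 0"
  proof -
    have "2 * B = 2 * ((\<Sum>j\<in>I. \<integral>x. kernel_op (KW j) F x * kernel_op (KW j) P x \<partial>N) / card I)"
      unfolding B_def using P_mult[OF P] by (simp add: power2_eq_square)
    also have "\<dots> = (\<Sum>j\<in>I. 2 * (\<integral>x. kernel_op (KW j) F x * kernel_op (KW j) P x \<partial>N)) / card I"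
      by (simp add: sum_distrib_left)
    also have "\<dots> \<le> (\<Sum>j\<in>I. w * (\<integral>x. (kernel_op (KW j) F x)\<^sup>2 \<partial>N) + (\<integral>x. (kernel_op (KW j) P x)\<^sup>2 \<partial>N) / w) / card I"
      using w by (intro divide_right_mono sum_mono integral_young EF EP) auto
    also have "\<dots> = w * A + ((\<Sum>j\<in>I. \<integral>x. (kernel_op (KW j) P x)\<^sup>2 \<partial>N) / card I) / w"
      unfolding A_def
      by (simp add: sum.distrib sum_distrib_left sum_divide_distrib add_divide_distrib mult.commute)
    also have "\<dots> \<le> w * A + (w\<^sup>2 * A) / w"
      using w by (intro add_mono divide_right_mono W2[OF A]) auto
    also have "\<dots> = 2 * (w * A)" using w by (simp add: power2_eq_square)
    finally show ?thesis by simp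
  qed
  have PF: "(\<integral>x. F x * P x \<partial>N) = A"
    using P_mult[OF F(1)] by (simp add: A_def power2_eq_square mult.commute)
  show ?thesis
  proof (cases "A > 0")
    case True
    have "2 * A \<le> w * (\<integral>x. (F x)\<^sup>2 \<partial>N) + B / w"
      using integral_young[OF F(1) P w] by (simp add: PF B_def)
    also have "B / w \<le> A" using B[OF True] w by (simp add: divide_le_eq mult.commute)
    finally show ?thesis by (simp add: A_def)
  next
    case False
    moreover have "0 \<le> w * (\<integral>x. (F x)\<^sup>2 \<partial>N)" using w by simp
    ultimately show ?thesis unfolding A_def by linarith
  qed
qed

lemma sum_E_sq_le:
  assumes w: "w \<ge> 0" and le: "kernel_norm \<phi> W \<le> ennreal w"
    and F: "sq_int N F" "(\<integral>x. F x \<partial>N) = 0"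
  shows "(\<Sum>j\<in>I. \<integral>x. (kernel_op (KW j) F x)\<^sup>2 \<partial>N) / card I \<le> w * (\<integral>x. (F x)\<^sup>2 \<partial>N)"
proof (cases "(\<integral>x. (F x)\<^sup>2 \<partial>N) = 0")
  case True
  thus ?thesis using sum_E_sq_le_aux[of "w + 1" F] w F order_trans[OF le, of "ennreal (w + 1)"] by (simp add: ennreal_leI)
next
  case False
  moreover have "0 \<le> (\<integral>x. (F x)\<^sup>2 \<partial>N)" by simp
  ultimately have pos: "0 < (\<integral>x. (F x)\<^sup>2 \<partial>N)" by linarith
  \<comment> \<open>The bound for positive \<open>w\<close> passes to the limit.\<close>
  have "(\<Sum>j\<in>I. \<integral>x. (kernel_op (KW j) F x)\<^sup>2 \<partial>N) / card I / (\<integral>x. (F x)\<^sup>2 \<partial>N) \<le> w"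
  proof (rule dense_ge)
    fix v assume v: "w < v"
    have "kernel_norm \<phi> W \<le> ennreal v" using v by (intro order_trans[OF le] ennreal_leI) simp
    with sum_E_sq_le_aux[of v F] v w F
    show "(\<Sum>j\<in>I. \<integral>x. (kernel_op (KW j) F x)\<^sup>2 \<partial>N) / card I / (\<integral>x. (F x)\<^sup>2 \<partial>N) \<le> v"
      by (intro pos_divide_le_eq[OF pos, THEN iffD2]) auto
  qed
  thus ?thesis by (rule pos_divide_le_eq[OF pos, THEN iffD1])
qed

end

context fibre begin

section \<open>The Gibbs sampler on a fibre\<close>

text \<open>
  The blocks of size \<open>l\<close> in the fibre, the stationary distribution \<open>\<nu>\<close> and the sampler live on the
  coordinates in \<open>I\<close> only.
\<close>

abbreviation blocks :: "nat \<Rightarrow> nat set set" where "blocks l \<equiv> {\<Gamma>. \<Gamma> \<subseteq> I \<and> card \<Gamma> = l}"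

lemma fin_blocks: "finite (blocks l)" using fin_I by simp

lemma blocks_ne: "l \<le> card I \<Longrightarrow> blocks l \<noteq> {}"
  using obtain_subset_with_card_n[of l I] by auto

abbreviation \<nu> :: "(nat \<Rightarrow> 'a) measure" where "\<nu> \<equiv> cond_dist n M p q I \<Lambda> y"
abbreviation GK :: "nat \<Rightarrow> (nat \<Rightarrow> 'a) \<Rightarrow> (nat \<Rightarrow> 'a) measure" where "GK l \<equiv> gibbs_kernel n M p q \<Lambda> y l"

lemma restr_meas: "(\<lambda>x. restrict x I) \<in> \<Omega> \<rightarrow>\<^sub>M Pi\<^sub>M I M"
  by (rule measurable_restrict_subset[OF I_sub])

lemma nu_eq: "\<nu> = distr N (Pi\<^sub>M I M) (\<lambda>x. restrict x I)"
  by (rule cond_dist_resample[OF order_refl I_sub x0 regular_x0])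

lemma upd_restrict:
  assumes "x \<in> space \<Omega>" "restrict x \<Lambda> = restrict x0 \<Lambda>" shows "upd I x0 (restrict x I) = x"
proof
  fix i
  have "x i = x0 i" if "i \<in> \<Lambda>" using fun_cong[OF assms(2), of i] that by simp
  moreover have "i \<notin> U \<Longrightarrow> x i = undefined" using assms(1) by (auto simp: space_PiM PiE_def extensional_def)
  ultimately show "upd I x0 (restrict x I) i = x i" by (auto simp: upd_apply)
qed

text \<open>
  At configurations that are regular for all blocks, the sampler is the uniform mixture of the resampling
  measures.
\<close>

lemma gibbs_kernel_eq:
  assumes z: "z \<in> space (Pi\<^sub>M I M)" and l: "l \<le> card I"
    and g: "\<And>\<Gamma>. \<Gamma> \<in> blocks l \<Longrightarrow> regular \<Gamma> (upd I x0 z)"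
  shows "GK l z = uniform_count_measure (blocks l) \<bind>
    (\<lambda>\<Gamma>. distr (resample \<Gamma> (upd I x0 z)) (Pi\<^sub>M I M) (\<lambda>x. restrict x I))"
proof -
  let ?x = "upd I x0 z"
  have x: "?x \<in> space \<Omega>" by (rule upd_space[OF I_sub x0 z])
  have UL: "U - \<Lambda> = I" using I_sub by auto
  have m: "merge \<Lambda> I (y, z) = ?x" using I_sub by (auto simp: fun_eq_iff merge_def upd_apply)
  show ?thesis
    unfolding gibbs_kernel_def U_eq[symmetric] UL m Let_def
  proof (rule bind_uniform_cong[OF _ blocks_ne[OF l]])
    fix \<Gamma> assume G: "\<Gamma> \<in> blocks l"
    hence sub: "\<Gamma> \<subseteq> U" using I_sub by auto
    have m: "upd \<Gamma> ?x \<in> cond_dist n M p q \<Gamma> (U - \<Gamma>) (restrict ?x (U - \<Gamma>)) \<rightarrow>\<^sub>M \<Omega>"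
      using upd_meas1[OF sub x] by (simp only: measurable_cong_sets[OF sets_cond_dist refl])
    have "(\<lambda>w. restrict (merge \<Gamma> (U - \<Gamma>) (w, ?x)) I) = (\<lambda>x. restrict x I) \<circ> upd \<Gamma> ?x"
      by (simp add: comp_def upd_def[of \<Gamma>])
    hence "distr (cond_dist n M p q \<Gamma> (U - \<Gamma>) (restrict ?x (U - \<Gamma>))) (Pi\<^sub>M I M)
          (\<lambda>w. restrict (merge \<Gamma> (U - \<Gamma>) (w, ?x)) I)
        = distr (distr (cond_dist n M p q \<Gamma> (U - \<Gamma>) (restrict ?x (U - \<Gamma>))) \<Omega> (upd \<Gamma> ?x)) (Pi\<^sub>M I M) (\<lambda>x. restrict x I)"
      by (simp only: distr_distr[OF restr_meas m])
    thus "distr (cond_dist n M p q \<Gamma> (U - \<Gamma>) (restrict ?x (U - \<Gamma>))) (Pi\<^sub>M I M)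
          (\<lambda>w. restrict (merge \<Gamma> (U - \<Gamma>) (w, ?x)) I)
        = distr (resample \<Gamma> ?x) (Pi\<^sub>M I M) (\<lambda>x. restrict x I)"
      unfolding distr_cond_dist_upd[OF sub x g[OF G]] .
  qed
qed

text \<open>
  The sampler acts as the average of the resampling kernels, and so its norm is controlled by its
  quadratic form.
\<close>

lemma gibbs_norm_le:
  assumes l: "l \<le> card I" and c: "c \<ge> 0"
    and form: "\<And>F. sq_int N F \<Longrightarrow> (\<integral>x. F x \<partial>N) = 0 \<Longrightarrow>
      (\<Sum>\<Gamma>\<in>blocks l. \<integral>x. (kernel_op (resample \<Gamma>) F x)\<^sup>2 \<partial>N) / card (blocks l) \<le> c * (\<integral>x. (F x)\<^sup>2 \<partial>N)"
  shows "kernel_norm \<nu> (GK l) \<le> ennreal c"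
proof (rule kernel_norm_leI[OF c])
  fix f assume f: "sq_int \<nu> f" "(\<integral>z. f z \<partial>\<nu>) = 0"
  note fb = fin_blocks[of l] blocks_ne[OF l]
  have fm: "f \<in> borel_measurable (Pi\<^sub>M I M)" using f(1) by (auto simp: sq_int_def nu_eq)
  define F where "F x = f (restrict x I)" for x
  have Fm: "F \<in> borel_measurable \<Omega>" unfolding F_def by (rule measurable_compose[OF restr_meas fm])
  have nu_int: "(\<integral>z. u z \<partial>\<nu>) = (\<integral>x. u (restrict x I) \<partial>N)" "integrable \<nu> u \<longleftrightarrow> integrable N (\<lambda>x. u (restrict x I))"
    if "u \<in> borel_measurable (Pi\<^sub>M I M)" for u :: "(nat \<Rightarrow> 'a) \<Rightarrow> real"
    unfolding nu_eq using that restr_meas by (auto simp: integral_distr integrable_distr_eq)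
  have nu_sq: "sq_int \<nu> u \<longleftrightarrow> sq_int N (\<lambda>x. u (restrict x I))" "(\<integral>z. (u z)\<^sup>2 \<partial>\<nu>) = (\<integral>x. (u (restrict x I))\<^sup>2 \<partial>N)"
    if u: "u \<in> borel_measurable (Pi\<^sub>M I M)" for u :: "(nat \<Rightarrow> 'a) \<Rightarrow> real"
    using u nu_int[of "\<lambda>z. (u z)\<^sup>2"] measurable_compose[OF restr_meas u]
    by (auto simp: sq_int_def measurable_cong_sets[OF sets_cond_dist refl])
  have F: "sq_int N F" "(\<integral>x. F x \<partial>N) = 0" "(\<integral>z. (f z)\<^sup>2 \<partial>\<nu>) = (\<integral>x. (F x)\<^sup>2 \<partial>N)"
    using f nu_int(1)[OF fm] nu_sq[OF fm] by (simp_all add: F_def[abs_def])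
  have K: "\<Gamma> \<in> blocks l \<Longrightarrow> cond_kernel N (resample \<Gamma>)" for \<Gamma> by (rule cond_kernel_block) auto
  have sub: "\<Gamma> \<in> blocks l \<Longrightarrow> \<Gamma> \<subseteq> U" for \<Gamma> using I_sub by auto
  define P where "P = (\<lambda>x. (\<Sum>\<Gamma>\<in>blocks l. kernel_op (resample \<Gamma>) F x) / card (blocks l))"
  have P: "sq_int N P" "(\<integral>x. (P x)\<^sup>2 \<partial>N) \<le> c\<^sup>2 * (\<integral>x. (F x)\<^sup>2 \<partial>N)"
    unfolding P_def
    by (rule average_projections_form(1)[OF fb K F(1) F(1)], assumption)
       (rule average_projections_norm[OF fb K c form F(1,2)], assumption+)
  have Pm: "P \<in> borel_measurable \<Omega>" using P(1) by (auto simp: sq_int_def)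
  \<comment> \<open>The image under the sampler, as a function of the coordinates in \<open>I\<close>.\<close>
  define g where "g z = P (upd I x0 z)" for z
  note um = upd_meas1[OF I_sub x0]
  have gm: "g \<in> borel_measurable (Pi\<^sub>M I M)" unfolding g_def by (rule measurable_compose[OF um Pm])
  have gP: "AE x in N. P x = g (restrict x I)"
    using AE_restrict by eventually_elim (simp add: g_def upd_restrict)
  have g1: "sq_int \<nu> g"
    unfolding nu_sq[OF gm]
    by (rule sq_int_cong_AE[OF P(1) _ gP]) (use measurable_compose[OF restr_meas gm] in simp)
  have g2: "(\<integral>z. (g z)\<^sup>2 \<partial>\<nu>) = (\<integral>x. (P x)\<^sup>2 \<partial>N)"
    unfolding nu_sq(2)[OF gm]
    using gP measurable_compose[OF restr_meas gm] Pm by (intro integral_cong_AE) auto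
  define G where "G x \<longleftrightarrow> (\<forall>\<Gamma>\<in>blocks l. regular \<Gamma> x \<and> integrable (resample \<Gamma> x) F)" for x
  have G_meas: "{x \<in> space \<Omega>. G x} \<in> sets \<Omega>"
    unfolding G_def using sub
    by (intro sets.sets_Collect_finite_All sets.sets_Collect_conj fin_blocks regular_meas integrable_resample_meas Fm) auto
  have "AE x in N. G x"
    unfolding G_def
  proof (intro AE_finite_allI fin_blocks)
    fix \<Gamma> assume G: "\<Gamma> \<in> blocks l"
    hence "AE x in N. regular \<Gamma> x" by (intro AE_regular_block) auto
    thus "AE x in N. regular \<Gamma> x \<and> integrable (resample \<Gamma> x) F"
      using cond_kernel.AE_integrable[OF K[OF G] sq_int_integrable[OF F(1)]] by eventually_elim simp
  qed
  hence "AE x in N. G (upd I x0 (restrict x I))"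
    using AE_restrict by eventually_elim (simp add: upd_restrict)
  moreover have "{z \<in> space (Pi\<^sub>M I M). G (upd I x0 z)} \<in> sets (Pi\<^sub>M I M)"
    using measurable_sets[OF um G_meas] upd_space[OF I_sub x0]
    by (simp add: vimage_def Int_def conj_commute cong: conj_cong)
  ultimately have "AE z in \<nu>. G (upd I x0 z)"
    unfolding nu_eq using restr_meas by (subst AE_distr_iff) auto
  moreover have "AE z in \<nu>. z \<in> space (Pi\<^sub>M I M)"
    using sets_eq_imp_space_eq[OF sets_cond_dist] by (intro AE_I2) simp
  ultimately have "AE z in \<nu>. kernel_op (GK l) f z = g z"
  proof eventually_elim
    fix z assume z: "G (upd I x0 z)" "z \<in> space (Pi\<^sub>M I M)"
    let ?x = "upd I x0 z"
    have x: "?x \<in> space \<Omega>" by (rule upd_space[OF I_sub x0 z(2)])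
    have mem: "distr (resample \<Gamma> ?x) (Pi\<^sub>M I M) (\<lambda>x. restrict x I) \<in> space (subprob_algebra (Pi\<^sub>M I M))"
      if "\<Gamma> \<in> blocks l" for \<Gamma>
    proof -
      have "resample \<Gamma> ?x \<in> space (subprob_algebra \<Omega>)"
        using measurable_space[OF resample_meas[OF sub[OF that]]] x by blast
      thus ?thesis using measurable_space[OF measurable_distr[OF restr_meas]] by blast
    qed
    interpret mix: uniform_mixture "blocks l" "Pi\<^sub>M I M" "\<lambda>\<Gamma>. distr (resample \<Gamma> ?x) (Pi\<^sub>M I M) (\<lambda>x. restrict x I)"
      by (rule uniform_mixture.intro[OF fb mem])
    have d: "integrable (distr (resample \<Gamma> ?x) (Pi\<^sub>M I M) (\<lambda>x. restrict x I)) f"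
      "(\<integral>z. f z \<partial>distr (resample \<Gamma> ?x) (Pi\<^sub>M I M) (\<lambda>x. restrict x I)) = kernel_op (resample \<Gamma>) F ?x"
      if "\<Gamma> \<in> blocks l" for \<Gamma>
      using restr_meas fm z(1) that
      by (auto simp: integrable_distr_eq integral_distr G_def F_def[abs_def] kernel_op_def)
    have eq: "GK l z = mix.mix"
      by (rule gibbs_kernel_eq[OF z(2) l]) (use z(1) in \<open>simp add: G_def\<close>)
    have "kernel_op (GK l) f z =
        (\<Sum>\<Gamma>\<in>blocks l. \<integral>z. f z \<partial>distr (resample \<Gamma> ?x) (Pi\<^sub>M I M) (\<lambda>x. restrict x I)) / card (blocks l)"
      unfolding kernel_op_def[of "GK l"] eq by (rule mix.mix_integral(2)[OF fm]) (rule d(1))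
    also have "\<dots> = g z" using d(2) by (simp add: g_def P_def)
    finally show "kernel_op (GK l) f z = g z" .
  qed
  thus "\<exists>g. sq_int \<nu> g \<and> (AE z in \<nu>. kernel_op (GK l) f z = g z) \<and> (\<integral>z. (g z)\<^sup>2 \<partial>\<nu>) \<le> c\<^sup>2 * (\<integral>z. (f z)\<^sup>2 \<partial>\<nu>)"
    using g1 g2 P(2) F(3) by auto
qed

lemma blocks_pred: "blocks (card I - 1) = (\<lambda>j. I - {j}) ` I"
proof (intro equalityI subsetI)
  fix \<Gamma> assume "\<Gamma> \<in> blocks (card I - 1)"
  hence G: "\<Gamma> \<subseteq> I" "card \<Gamma> = card I - 1" by auto
  have "card (I - \<Gamma>) = 1" using G card_I fin_I finite_subset[OF G(1) fin_I] by (simp add: card_Diff_subset)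
  then obtain j where "I - \<Gamma> = {j}" by (auto simp: card_1_singleton_iff)
  hence "\<Gamma> = I - {j}" "j \<in> I" using G by auto
  thus "\<Gamma> \<in> (\<lambda>j. I - {j}) ` I" by blast
qed (use fin_I in auto)

lemma inj_remove: "inj_on (\<lambda>j. I - {j}) I" by (auto simp: inj_on_def)

lemma gibbs_norm_le_walk_norm: "kernel_norm \<nu> (GK (card I - 1)) \<le> kernel_norm \<phi> W"
proof -
  define w where "w = enn2real (kernel_norm \<phi> W)"
  have w: "kernel_norm \<phi> W = ennreal w" "w \<ge> 0"
    using walk_norm_le_1 by (auto simp: w_def ennreal_enn2real_if top_unique)
  have s: "(\<Sum>\<Gamma>\<in>blocks (card I - 1). g \<Gamma>) = (\<Sum>j\<in>I. g (I - {j}))" for g :: "nat set \<Rightarrow> real"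
    unfolding blocks_pred by (subst sum.reindex[OF inj_remove]) simp
  have cb: "card (blocks (card I - 1)) = card I" unfolding blocks_pred by (rule card_image[OF inj_remove])
  show ?thesis unfolding w(1)
  proof (rule gibbs_norm_le)
    fix F assume F: "sq_int N F" "(\<integral>x. F x \<partial>N) = 0"
    show "(\<Sum>\<Gamma>\<in>blocks (card I - 1). \<integral>x. (kernel_op (resample \<Gamma>) F x)\<^sup>2 \<partial>N) / card (blocks (card I - 1))
        \<le> w * (\<integral>x. (F x)\<^sup>2 \<partial>N)"
      unfolding s cb by (rule sum_E_sq_le[OF w(2) _ F]) (simp add: w)
  qed (use w in auto)
qed

text \<open>
  The same estimate for a function with arbitrary mean; this is the form that can be integrated over
  the conditioning points.
\<close>

lemma sum_E_sq_le_uncentered: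
  assumes w: "w \<ge> 0" and le: "kernel_norm \<phi> W \<le> ennreal w" and F: "sq_int N F"
  shows "(\<Sum>j\<in>I. \<integral>x. (kernel_op (KW j) F x)\<^sup>2 \<partial>N) / card I
      \<le> w * (\<integral>x. (F x)\<^sup>2 \<partial>N) + (1 - w) * (\<integral>x. F x \<partial>N)\<^sup>2"
proof -
  define \<mu> where "\<mu> = (\<integral>x. F x \<partial>N)"
  have K: "cond_kernel N (KW j)" for j by (rule cond_kernel_block) auto
  have var: "(\<integral>x. (u x - \<mu>)\<^sup>2 \<partial>N) = (\<integral>x. (u x)\<^sup>2 \<partial>N) - \<mu>\<^sup>2" if "sq_int N u" "(\<integral>x. u x \<partial>N) = \<mu>" for u
    using variance_eq[of u] that sq_int_integrable[OF that(1)] by (auto simp: sq_int_def)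
  have F': "sq_int N (\<lambda>x. F x - \<mu>)" using sq_int_add[OF F, of "\<lambda>_. - \<mu>"] by simp
  have F0: "(\<integral>x. F x - \<mu> \<partial>N) = 0" using sq_int_integrable[OF F] by (simp add: \<mu>_def prob_space[simplified])
  have E: "(\<integral>x. (kernel_op (KW j) (\<lambda>x. F x - \<mu>) x)\<^sup>2 \<partial>N) = (\<integral>x. (kernel_op (KW j) F x)\<^sup>2 \<partial>N) - \<mu>\<^sup>2" for j
  proof -
    have EF: "sq_int N (kernel_op (KW j) F)" by (rule cond_kernel.E_sq_int[OF K F])
    have EF': "sq_int N (kernel_op (KW j) (\<lambda>x. F x - \<mu>))" by (rule cond_kernel.E_sq_int[OF K F'])
    have "AE x in N. kernel_op (KW j) (\<lambda>x. F x - \<mu>) x = kernel_op (KW j) F x - \<mu>"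
      using cond_kernel.AE_integrable[OF K sq_int_integrable[OF F], of j] cond_kernel.AE_prob[OF K, of j]
    proof eventually_elim
      case (elim x)
      interpret J: prob_space "KW j x" by fact
      show ?case using elim(1) J.prob_space[simplified] by (simp add: kernel_op_def)
    qed
    hence "(\<integral>x. (kernel_op (KW j) (\<lambda>x. F x - \<mu>) x)\<^sup>2 \<partial>N) = (\<integral>x. (kernel_op (KW j) F x - \<mu>)\<^sup>2 \<partial>N)"
      using sq_intD(1)[OF EF] sq_intD(1)[OF EF'] by (intro integral_cong_AE) auto
    also have "\<dots> = (\<integral>x. (kernel_op (KW j) F x)\<^sup>2 \<partial>N) - \<mu>\<^sup>2"
      by (rule var[OF EF]) (simp add: cond_kernel.E_integral(2)[OF K sq_int_integrable[OF F]] \<mu>_def)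
    finally show ?thesis .
  qed
  have "(\<Sum>j\<in>I. \<integral>x. (kernel_op (KW j) F x)\<^sup>2 \<partial>N) / card I - \<mu>\<^sup>2
      = (\<Sum>j\<in>I. (\<integral>x. (kernel_op (KW j) F x)\<^sup>2 \<partial>N) - \<mu>\<^sup>2) / card I"
    using card_I by (simp add: sum_subtractf diff_divide_distrib)
  also have "\<dots> \<le> w * ((\<integral>x. (F x)\<^sup>2 \<partial>N) - \<mu>\<^sup>2)"
    using sum_E_sq_le[OF w le F' F0] unfolding E var[OF F \<mu>_def[symmetric]] .
  finally show ?thesis unfolding \<mu>_def by (simp add: algebra_simps)
qed

end

section \<open>The spectral telescope\<close>

text \<open>
  Double counting: a pair of a set \<open>I\<close> of size \<open>m\<close> and an element \<open>j\<close> of it corresponds to the pair of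
  \<open>I - {j}\<close> and an element \<open>j\<close> outside it.
\<close>

lemma sum_remove_element:
  fixes g :: "nat set \<Rightarrow> real"
  assumes U: "finite U" and m: "m \<ge> 1" "m \<le> card U"
  shows "(\<Sum>I\<in>{I. I \<subseteq> U \<and> card I = m}. \<Sum>j\<in>I. g (I - {j})) =
      (card U - m + 1) * (\<Sum>\<Gamma>\<in>{\<Gamma>. \<Gamma> \<subseteq> U \<and> card \<Gamma> = m - 1}. g \<Gamma>)"
proof -
  let ?B = "\<lambda>m. {I. I \<subseteq> U \<and> card I = m}"
  have fin: "finite (?B k)" for k using U by simp
  have fin': "I \<subseteq> U \<Longrightarrow> finite I" for I using U by (rule rev_finite_subset)
  have "(\<Sum>I\<in>?B m. \<Sum>j\<in>I. g (I - {j})) = (\<Sum>(I, j)\<in>Sigma (?B m) (\<lambda>I. I). g (I - {j}))"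
    using fin fin' by (intro sum.Sigma) auto
  also have "\<dots> = (\<Sum>(\<Gamma>, j)\<in>Sigma (?B (m - 1)) (\<lambda>\<Gamma>. U - \<Gamma>). g \<Gamma>)"
  proof (rule sum.reindex_bij_witness[where i="\<lambda>(\<Gamma>, j). (insert j \<Gamma>, j)" and j="\<lambda>(I, j). (I - {j}, j)"])
    fix a assume "a \<in> Sigma (?B (m - 1)) (\<lambda>\<Gamma>. U - \<Gamma>)"
    thus "(case a of (\<Gamma>, j) \<Rightarrow> (insert j \<Gamma>, j)) \<in> Sigma (?B m) (\<lambda>I. I)"
      using m U by (auto simp: card_insert_if fin')
  qed (use U in \<open>auto simp: fin' insert_absorb\<close>)
  also have "\<dots> = (\<Sum>\<Gamma>\<in>?B (m - 1). \<Sum>j\<in>U - \<Gamma>. g \<Gamma>)"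
    using fin U by (intro sum.Sigma[symmetric]) auto
  also have "\<dots> = (\<Sum>\<Gamma>\<in>?B (m - 1). real (card U - m + 1) * g \<Gamma>)"
    using m U by (intro sum.cong) (auto simp: card_Diff_subset fin')
  finally show ?thesis by (simp add: sum_distrib_left)
qed

context joint_density begin

abbreviation \<pi> :: "(nat \<Rightarrow> 'a) measure" where "\<pi> \<equiv> density \<Omega> (\<lambda>x. ennreal (p x))"

text \<open>
  The quadratic form of the sampler with block size \<open>m\<close> targeting the joint distribution: the average over the
  blocks \<open>\<Gamma>\<close> of size \<open>m\<close> of the squared norm of the conditional expectation given the coordinates outside
  \<open>\<Gamma>\<close>.
\<close>

definition energy :: "((nat \<Rightarrow> 'a) \<Rightarrow> real) \<Rightarrow> nat \<Rightarrow> real" where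
  "energy F m = (\<Sum>\<Gamma>\<in>{\<Gamma>. \<Gamma> \<subseteq> U \<and> card \<Gamma> = m}. \<integral>x. (kernel_op (resample \<Gamma>) F x)\<^sup>2 \<partial>\<pi>) / card {\<Gamma>. \<Gamma> \<subseteq> U \<and> card \<Gamma> = m}"

lemma fin_U: "finite U" by (simp add: U_eq)
lemma card_U: "card U = n" by (simp add: U_eq)

lemma space_ne: "\<exists>x. x \<in> space \<Omega>"
  using prob_space.not_empty[OF prob_p] unfolding space_density by blast

lemma cond_kernel_pi: "\<Gamma> \<subseteq> U \<Longrightarrow> cond_kernel \<pi> (resample \<Gamma>)"
  using space_ne cond_kernel_resample[of \<Gamma> U] resample_U by auto

lemma AE_regular_pi: "\<Gamma> \<subseteq> U \<Longrightarrow> AE x in \<pi>. regular \<Gamma> x"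
  by (rule exE[OF space_ne]) (metis AE_regular resample_U order_refl)

lemma fibreI:
  "I \<subseteq> U \<Longrightarrow> I \<noteq> {} \<Longrightarrow> x \<in> space \<Omega> \<Longrightarrow> regular I x \<Longrightarrow> fibre U n M p I x"
  by (simp add: fibre_def fibre_axioms_def joint_density_axioms)

text \<open>
  Integrating the estimate on the fibres over the coordinates outside \<open>I\<close>.  The mean of \<open>F\<close> on a fibre is its
  conditional expectation, which is where the last term comes from.
\<close>

lemma telescope_block:
  assumes I: "I \<subseteq> U" "I \<noteq> {}" and c: "c \<ge> 0"
    and W: "\<And>x. x \<in> space \<Omega> \<Longrightarrow> regular I x \<Longrightarrow>
      kernel_norm (walk_stationary n M p q (U - I) (restrict x (U - I)))
        (walk_kernel n M p q (U - I) (restrict x (U - I))) \<le> ennreal c"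
    and F: "sq_int \<pi> F"
  shows "(\<Sum>j\<in>I. \<integral>x. (kernel_op (resample (I - {j})) F x)\<^sup>2 \<partial>\<pi>) / card I
      \<le> c * (\<integral>x. (F x)\<^sup>2 \<partial>\<pi>) + (1 - c) * (\<integral>x. (kernel_op (resample I) F x)\<^sup>2 \<partial>\<pi>)"
proof -
  note KI = cond_kernel_pi[OF I(1)]
  have sub: "I - {j} \<subseteq> U" for j using I by auto
  have EF: "sq_int \<pi> (kernel_op (resample (I - {j})) F)" for j
    by (rule cond_kernel.E_sq_int[OF cond_kernel_pi[OF sub] F])
  have EIF: "sq_int \<pi> (kernel_op (resample I) F)" by (rule cond_kernel.E_sq_int[OF KI F])
  let ?u = "\<lambda>j x. kernel_op (resample I) (\<lambda>x. (kernel_op (resample (I - {j})) F x)\<^sup>2) x"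
  note E1 = cond_kernel.E_integral[OF KI sq_intD(2)[OF EF]]
  note E2 = cond_kernel.E_integral[OF KI sq_intD(2)[OF F]]
  have "AE x in \<pi>. (\<Sum>j\<in>I. ?u j x) / card I
      \<le> c * kernel_op (resample I) (\<lambda>x. (F x)\<^sup>2) x + (1 - c) * (kernel_op (resample I) F x)\<^sup>2"
    using AE_regular_pi[OF I(1)] cond_kernel.AE_sq_int[OF KI F] AE_space
  proof eventually_elim
    case (elim x)
    hence x: "x \<in> space \<Omega>" by simp
    show ?case unfolding kernel_op_def[of "resample I"]
      by (rule fibre.sum_E_sq_le_uncentered[OF fibreI[OF I x elim(1)] c W[OF x elim(1)] elim(2)])
  qed
  hence "(\<integral>x. (\<Sum>j\<in>I. ?u j x) / card I \<partial>\<pi>)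
      \<le> (\<integral>x. c * kernel_op (resample I) (\<lambda>x. (F x)\<^sup>2) x + (1 - c) * (kernel_op (resample I) F x)\<^sup>2 \<partial>\<pi>)"
    using E1(1) E2(1) sq_intD(2)[OF EIF] by (intro integral_mono_AE) auto
  moreover have "(\<integral>x. (\<Sum>j\<in>I. ?u j x) / card I \<partial>\<pi>) = (\<Sum>j\<in>I. \<integral>x. (kernel_op (resample (I - {j})) F x)\<^sup>2 \<partial>\<pi>) / card I"
    using E1 by simp
  moreover have "(\<integral>x. c * kernel_op (resample I) (\<lambda>x. (F x)\<^sup>2) x + (1 - c) * (kernel_op (resample I) F x)\<^sup>2 \<partial>\<pi>)
      = c * (\<integral>x. (F x)\<^sup>2 \<partial>\<pi>) + (1 - c) * (\<integral>x. (kernel_op (resample I) F x)\<^sup>2 \<partial>\<pi>)"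
    using E2 sq_intD(2)[OF EIF] by simp
  ultimately show ?thesis by (simp only:)
qed

text \<open>
  The norms of all walks that move on \<open>m\<close> coordinates are at most \<open>c\<close>.
\<close>

definition walk_bound :: "'a cond_family \<Rightarrow> nat \<Rightarrow> real \<Rightarrow> bool" where
  "walk_bound q m c \<longleftrightarrow> (\<forall>I x. I \<subseteq> U \<and> card I = m \<and> x \<in> space \<Omega> \<and> regular I x \<longrightarrow>
      kernel_norm (walk_stationary n M p q (U - I) (restrict x (U - I)))
        (walk_kernel n M p q (U - I) (restrict x (U - I))) \<le> ennreal c)"

text \<open>
  Equivalently, \<open>|F|^2 - energy F (m - 1)\<close> is at least \<open>(1 - c) (|F|^2 - energy F m)\<close>.
\<close>

lemma telescope_step:
  assumes m: "1 \<le> m" "m \<le> n" and c: "c \<ge> 0" and W: "walk_bound q m c" and F: "sq_int \<pi> F"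
  shows "energy F (m - 1) \<le> c * (\<integral>x. (F x)\<^sup>2 \<partial>\<pi>) + (1 - c) * energy F m"
proof -
  let ?B = "\<lambda>m. {I. I \<subseteq> U \<and> card I = m}"
  let ?a = "\<lambda>\<Gamma>. \<integral>x. (kernel_op (resample \<Gamma>) F x)\<^sup>2 \<partial>\<pi>"
  let ?X = "\<integral>x. (F x)\<^sup>2 \<partial>\<pi>"
  have fin: "finite (?B k)" for k using fin_U by simp
  have ne: "card (?B k) > 0" if "k \<le> n" for k
    using obtain_subset_with_card_n[of k U] that fin[of k] by (auto simp: card_gt_0_iff card_U)
  note dc = sum_remove_element[OF fin_U m(1)]
  have k: "real m * card (?B m) = real (n - m + 1) * card (?B (m - 1))"
    using dc[of "\<lambda>_. 1"] m by (simp add: card_U mult.commute)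
  have pos: "real (card (?B m)) > 0" "real (card (?B (m - 1))) > 0" "real m > 0" "real (n - m + 1) > 0"
    using ne[of m] ne[of "m - 1"] m by auto
  have "energy F (m - 1) = (real (n - m + 1) * (\<Sum>\<Gamma>\<in>?B (m - 1). ?a \<Gamma>)) / (real (n - m + 1) * card (?B (m - 1)))"
    using pos by (simp add: energy_def)
  also have "\<dots> = (\<Sum>I\<in>?B m. \<Sum>j\<in>I. ?a (I - {j})) / (real m * card (?B m))"
    using dc[of ?a] m unfolding k by (simp add: card_U)
  also have "\<dots> = (\<Sum>I\<in>?B m. (\<Sum>j\<in>I. ?a (I - {j})) / card I) / card (?B m)"
    by (simp add: sum_divide_distrib)
  also have "\<dots> \<le> (\<Sum>I\<in>?B m. c * ?X + (1 - c) * ?a I) / card (?B m)"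
  proof (intro divide_right_mono sum_mono telescope_block[OF _ _ c _ F])
    fix I x assume "I \<in> ?B m" "x \<in> space \<Omega>" "regular I x"
    thus "kernel_norm (walk_stationary n M p q (U - I) (restrict x (U - I)))
        (walk_kernel n M p q (U - I) (restrict x (U - I))) \<le> ennreal c"
      using W by (simp add: walk_bound_def)
  qed (use m in auto)
  also have "\<dots> = c * ?X + (1 - c) * energy F m"
    using pos(1) by (simp add: energy_def sum.distrib add_divide_distrib flip: sum_distrib_left)
  finally show ?thesis .
qed

lemma energy_top: assumes "(\<integral>x. F x \<partial>\<pi>) = 0" shows "energy F n = 0"
proof -
  have B: "{\<Gamma>. \<Gamma> \<subseteq> U \<and> card \<Gamma> = n} = {U}"
    using card_subset_eq[OF fin_U] card_U by auto
  have "(\<integral>x. (kernel_op (resample U) F x)\<^sup>2 \<partial>\<pi>) = (\<integral>x. 0 \<partial>\<pi>)"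
    by (intro Bochner_Integration.integral_cong refl) (simp add: kernel_op_def resample_U assms)
  thus ?thesis by (simp add: energy_def B)
qed

lemma telescope:
  assumes l: "1 \<le> l" "l \<le> n" and c: "\<And>m. m \<in> {l+1..n} \<Longrightarrow> 0 \<le> c m \<and> c m \<le> 1"
    and W: "\<And>m. m \<in> {l+1..n} \<Longrightarrow> walk_bound q m (c m)"
    and F: "sq_int \<pi> F" "(\<integral>x. F x \<partial>\<pi>) = 0"
  shows "energy F l \<le> (1 - (\<Prod>m=l+1..n. 1 - c m)) * (\<integral>x. (F x)\<^sup>2 \<partial>\<pi>)"
  using l(2,1) c W
proof (induction l rule: inc_induct)
  case base
  show ?case using energy_top[OF F(2)] by simp
next
  case (step k)
  let ?X = "\<integral>x. (F x)\<^sup>2 \<partial>\<pi>" and ?c = "c (Suc k)" and ?P = "\<Prod>m=Suc k+1..n. 1 - c m"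
  have IH: "energy F (Suc k) \<le> (1 - ?P) * ?X"
    using step.prems by (intro step.IH) auto
  have c1: "0 \<le> ?c" "?c \<le> 1" using step.hyps step.prems(2)[of "Suc k"] by auto
  have W1: "walk_bound q (Suc k) ?c" using step.hyps by (intro step.prems(3)) auto
  have "energy F k \<le> ?c * ?X + (1 - ?c) * energy F (Suc k)"
    using telescope_step[OF _ _ c1(1) W1 F(1)] step.hyps by simp
  also have "\<dots> \<le> ?c * ?X + (1 - ?c) * ((1 - ?P) * ?X)"
    using c1 by (intro add_left_mono mult_left_mono IH) auto
  also have "\<dots> = (1 - (1 - ?c) * ?P) * ?X" by (simp add: algebra_simps)
  also have "(1 - ?c) * ?P = (\<Prod>m=k+1..n. 1 - c m)"
    using step.hyps prod.atLeast_Suc_atMost[of "k+1" n "\<lambda>m. 1 - c m"] by simp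
  finally show ?case .
qed

section \<open>Gaps\<close>

lemma obtain_fibre:
  assumes L: "L \<subseteq> U" "y \<in> space (Pi\<^sub>M L M)" "marginal n M p L y > 0"
  obtains x where "x \<in> space \<Omega>" "restrict x L = y" "regular (U - L) x"
proof -
  obtain x1 where x1: "x1 \<in> space \<Omega>" using space_ne by auto
  let ?x = "upd L x1 y"
  have x: "?x \<in> space \<Omega>" by (rule upd_space[OF L(1) x1 L(2)])
  have r: "restrict ?x L = y"
    using L(2) by (auto simp: fun_eq_iff upd_apply restrict_def space_PiM PiE_def extensional_def)
  have "U - (U - L) = L" using L(1) by auto
  hence "regular (U - L) ?x" using marginal_pos[of "U - L" ?x] x r L(3) by auto
  thus ?thesis using that x r by blast
qed

lemma spectral_gap_le_iff:
  assumes "0 \<le> c"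
  shows "ereal (1 - c) \<le> spectral_gap N K \<longleftrightarrow> kernel_norm N K \<le> ennreal c"
proof (cases "kernel_norm N K")
  case (real r)
  thus ?thesis using assms by (simp add: spectral_gap_def ennreal_le_iff2 one_ereal_def) argo
next
  case top
  thus ?thesis by (simp add: spectral_gap_def one_ereal_def top_unique)
qed

lemma walk_gap_range:
  assumes "L \<subset> U" "y \<in> space (Pi\<^sub>M L M)" "marginal n M p L y > 0"
  shows "0 \<le> walk_gap n M p q L y" "walk_gap n M p q L y \<le> 1"
    "walk_gap n M p q L y \<le> gibbs_gap n M p q L y (card (U - L) - 1)"
proof -
  obtain x where x: "x \<in> space \<Omega>" "restrict x L = y" "regular (U - L) x"
    using obtain_fibre assms by blast
  have UL: "U - (U - L) = L" using assms by auto
  interpret fibre U n M p q "U - L" x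
    using assms x by (intro fibreI) auto
  show "0 \<le> walk_gap n M p q L y"
    using walk_norm_le_1 spectral_gap_le_iff[of 1 "walk_stationary n M p q L y" "walk_kernel n M p q L y"]
    by (simp add: walk_gap_def UL x(2) zero_ereal_def)
  show "walk_gap n M p q L y \<le> 1"
    unfolding walk_gap_def spectral_gap_def using ereal_minus_mono[of 1 1 0] by simp
  show "walk_gap n M p q L y \<le> gibbs_gap n M p q L y (card (U - L) - 1)"
    using gibbs_norm_le_walk_norm unfolding UL x(2) walk_gap_def gibbs_gap_def spectral_gap_def U_eq[symmetric]
    by (intro ereal_minus_mono order_refl) (simp only: less_eq_ennreal.rep_eq)
qed

lemma fin_Lambda: "finite {L. L \<subseteq> U \<and> card L = k}" using fin_U by simp
lemma Lambda_ne: "k \<le> n \<Longrightarrow> {L. L \<subseteq> U \<and> card L = k} \<noteq> {}"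
  using obtain_subset_with_card_n[of k U] card_U by auto

lemma walk_Gap_le:
  assumes "L \<subseteq> U" "card L = n - m" "y \<in> space (Pi\<^sub>M L M)" "marginal n M p L y > 0"
  shows "walk_Gap n M p q m \<le> walk_gap n M p q L y"
proof -
  have "walk_Gap n M p q m \<le> (INF y\<in>{y \<in> space (Pi\<^sub>M L M). marginal n M p L y > 0}. walk_gap n M p q L y)"
    unfolding walk_Gap_def U_eq[symmetric] using fin_Lambda assms by (intro Min_le) auto
  also have "\<dots> \<le> walk_gap n M p q L y" using assms by (intro INF_lower) auto
  finally show ?thesis .
qed

lemma walk_Gap_ge:
  assumes "m \<le> n"
    and "\<And>L y. L \<subseteq> U \<Longrightarrow> card L = n - m \<Longrightarrow> y \<in> space (Pi\<^sub>M L M) \<Longrightarrow> marginal n M p L y > 0 \<Longrightarrow>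
      b \<le> walk_gap n M p q L y"
  shows "b \<le> walk_Gap n M p q m"
  unfolding walk_Gap_def U_eq[symmetric]
  using fin_Lambda[of "n - m"] Lambda_ne[of "n - m"] assms
  by (subst Min_ge_iff) (auto intro!: INF_greatest)

lemma Gap_ge:
  assumes "m \<le> n"
    and "\<And>L y. L \<subseteq> U \<Longrightarrow> card L = n - m \<Longrightarrow> y \<in> space (Pi\<^sub>M L M) \<Longrightarrow> marginal n M p L y > 0 \<Longrightarrow>
      b \<le> gibbs_gap n M p q L y l"
  shows "b \<le> Gap n M p q m l"
  unfolding Gap_def U_eq[symmetric]
  using fin_Lambda[of "n - m"] Lambda_ne[of "n - m"] assms
  by (subst Min_ge_iff) (auto intro!: INF_greatest)

lemma proper_Lambda: "L \<subseteq> U \<Longrightarrow> card L = n - m \<Longrightarrow> 1 \<le> m \<Longrightarrow> m \<le> n \<Longrightarrow> L \<subset> U \<and> card (U - L) = m"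
  using card_U fin_U by (auto simp: card_Diff_subset rev_finite_subset[OF fin_U])

lemma walk_Gap_range:
  assumes m: "1 \<le> m" "m \<le> n" shows "0 \<le> walk_Gap n M p q m" "walk_Gap n M p q m \<le> 1"
proof -
  show "0 \<le> walk_Gap n M p q m"
    using proper_Lambda[OF _ _ m] by (intro walk_Gap_ge m walk_gap_range(1)) auto
  \<comment> \<open>The infimum ranges over a nonempty set: almost every configuration is regular.\<close>
  obtain L where L: "L \<subseteq> U" "card L = n - m" using Lambda_ne[of "n - m"] by auto
  have "prob_space \<pi>" by (rule prob_p)
  hence "\<exists>x\<in>space \<pi>. regular (U - L) x"
    using AE_regular_pi[of "U - L"] prob_space.AE_contr[of \<pi>] by (meson AE_I2 AE_mp Diff_subset)
  then obtain x where x: "x \<in> space \<Omega>" "regular (U - L) x" by auto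
  have UL: "U - (U - L) = L" using L by auto
  have y: "restrict x L \<in> space (Pi\<^sub>M L M)"
    using measurable_space[OF measurable_restrict_subset[OF L(1)] x(1)] .
  have pos: "marginal n M p L (restrict x L) > 0"
    using marginal_pos[of "U - L" x] x UL by auto
  show "walk_Gap n M p q m \<le> 1"
    using walk_Gap_le[OF L y pos] walk_gap_range(2)[OF _ y pos] proper_Lambda[OF L m] by (blast intro: order_trans)
qed

theorem Gap_pred_ge:
  assumes m: "1 \<le> m" "m \<le> n" shows "walk_Gap n M p q m \<le> Gap n M p q m (m - 1)"
proof (rule Gap_ge[OF m(2)])
  fix L y assume L: "L \<subseteq> U" "card L = n - m" "y \<in> space (Pi\<^sub>M L M)" "marginal n M p L y > 0"
  note proper = proper_Lambda[OF L(1,2) m]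
  show "walk_Gap n M p q m \<le> gibbs_gap n M p q L y (m - 1)"
    using walk_Gap_le[OF L] walk_gap_range(3)[of L y q] L proper by (auto intro: order_trans)
qed

theorem Gap_ge_prod:
  assumes l: "1 \<le> l" "l \<le> n" shows "(\<Prod>m=l+1..n. walk_Gap n M p q m) \<le> Gap n M p q n l"
proof (rule Gap_ge[OF order_refl])
  fix L y assume L: "L \<subseteq> U" "card L = n - n" "y \<in> space (Pi\<^sub>M L M)" "marginal n M p L y > 0"
  have L0: "L = {}" using L(1,2) finite_subset[OF L(1) fin_U] by simp
  obtain x where x: "x \<in> space \<Omega>" "restrict x L = y" "regular (U - L) x"
    using obtain_fibre[OF L(1,3,4)] .
  have Une: "U \<noteq> {}" using l card_U by auto
  interpret fibre U n M p q U x using x Une L0 by (intro fibreI) auto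
  define g where "g m = real_of_ereal (walk_Gap n M p q m)" for m
  have g: "walk_Gap n M p q m = ereal (g m)" "0 \<le> g m" "g m \<le> 1" if "m \<in> {l+1..n}" for m
  proof -
    have r: "0 \<le> walk_Gap n M p q m" "walk_Gap n M p q m \<le> 1" using walk_Gap_range[of m q] that l by auto
    thus "walk_Gap n M p q m = ereal (g m)" unfolding g_def by (cases "walk_Gap n M p q m") auto
    with r show "0 \<le> g m" "g m \<le> 1" by auto
  qed
  have W: "walk_bound q m (1 - g m)" if m: "m \<in> {l+1..n}" for m
    unfolding walk_bound_def
  proof (intro allI impI, elim conjE)
    fix I x assume I: "I \<subseteq> U" "card I = m" and x: "x \<in> space \<Omega>" "regular I x"
    have UI: "U - (U - I) = I" using I by auto
    have y: "restrict x (U - I) \<in> space (Pi\<^sub>M (U - I) M)"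
      using measurable_space[OF measurable_restrict_subset[of "U - I" U] x(1)] by auto
    have "card (U - I) = n - m" using I card_U finite_subset[OF I(1) fin_U] by (simp add: card_Diff_subset)
    hence "walk_Gap n M p q m \<le> walk_gap n M p q (U - I) (restrict x (U - I))"
      using marginal_pos[OF I(1) x(1)] x(2) y by (intro walk_Gap_le) auto
    thus "kernel_norm (walk_stationary n M p q (U - I) (restrict x (U - I)))
        (walk_kernel n M p q (U - I) (restrict x (U - I))) \<le> ennreal (1 - g m)"
      using g[OF m] by (intro spectral_gap_le_iff[THEN iffD1]) (auto simp: walk_gap_def)
  qed
  define P where "P = (\<Prod>m=l+1..n. g m)"
  have P: "0 \<le> P" "P \<le> 1" unfolding P_def using g by (auto intro!: prod_nonneg prod_le_1)
  have "kernel_norm \<nu> (GK l) \<le> ennreal (1 - P)"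
  proof (rule gibbs_norm_le)
    fix F assume F: "sq_int (resample U x) F" "(\<integral>x. F x \<partial>resample U x) = 0"
    have "energy F l \<le> (1 - (\<Prod>m=l+1..n. 1 - (1 - g m))) * (\<integral>x. (F x)\<^sup>2 \<partial>\<pi>)"
      using F g W by (intro telescope[OF l]) (auto simp: resample_U[OF x(1)])
    thus "(\<Sum>\<Gamma>\<in>blocks l. \<integral>x. (kernel_op (resample \<Gamma>) F x)\<^sup>2 \<partial>resample U x) / card (blocks l)
        \<le> (1 - P) * (\<integral>x. (F x)\<^sup>2 \<partial>resample U x)"
      by (simp add: energy_def resample_U[OF x(1)] P_def)
  qed (use P l card_U in auto)
  hence "ereal P \<le> spectral_gap \<nu> (GK l)" using spectral_gap_le_iff[of "1 - P" \<nu> "GK l"] P by simp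
  moreover have "(\<Prod>m=l+1..n. walk_Gap n M p q m) = (\<Prod>m=l+1..n. ereal (g m))"
    by (intro prod.cong refl g(1))
  moreover have "(\<Prod>m=l+1..n. ereal (g m)) = ereal P"
    unfolding P_def by (simp add: prod_ereal)
  ultimately show "(\<Prod>m=l+1..n. walk_Gap n M p q m) \<le> gibbs_gap n M p q L y l"
    unfolding gibbs_gap_def U_eq[symmetric] x(2)[symmetric] L0 by simp
qed

end

theorem corollary4:
  fixes n :: nat
    and M :: "nat \<Rightarrow> 'a measure"
    and p :: "(nat \<Rightarrow> 'a) \<Rightarrow> real"
    and q :: "nat set \<Rightarrow> nat set \<Rightarrow> (nat \<Rightarrow> 'a) \<Rightarrow> (nat \<Rightarrow> 'a) \<Rightarrow> real"
  assumes "n \<ge> 2"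
    and "\<And>i. i \<in> {1..n} \<Longrightarrow> sigma_finite_measure (M i)"
    and "\<And>i x. i \<in> {1..n} \<Longrightarrow> x \<in> space (M i) \<Longrightarrow> {x} \<in> sets (M i)"
    and "p \<in> borel_measurable (Pi\<^sub>M {1..n} M)"
    and "\<And>x. x \<in> space (Pi\<^sub>M {1..n} M) \<Longrightarrow> p x \<ge> 0"
    and "prob_space (density (Pi\<^sub>M {1..n} M) (\<lambda>x. ennreal (p x)))"
    and "\<And>\<Lambda> \<Gamma> y. \<lbrakk>\<Lambda> \<subseteq> {1..n}; \<Gamma> \<subseteq> {1..n}; \<Lambda> \<inter> \<Gamma> = {}; \<Lambda> \<noteq> {}; \<Gamma> \<noteq> {};
           y \<in> space (Pi\<^sub>M \<Lambda> M); marginal n M p \<Lambda> y = 0\<rbrakk> \<Longrightarrow>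
           q \<Gamma> \<Lambda> y \<in> borel_measurable (Pi\<^sub>M \<Gamma> M) \<and>
           (\<forall>z\<in>space (Pi\<^sub>M \<Gamma> M). q \<Gamma> \<Lambda> y z \<ge> 0) \<and>
           prob_space (density (Pi\<^sub>M \<Gamma> M) (\<lambda>z. ennreal (q \<Gamma> \<Lambda> y z)))"
  shows "(\<forall>m\<in>{2..n}. Gap n M p q m (m - 1) \<ge> walk_Gap n M p q m) \<and>
         (\<forall>l\<in>{1..n - 1}. Gap n M p q n l \<ge> (\<Prod>m = l + 1..n. walk_Gap n M p q m))"
proof -
  have *: "joint_density {1..n} n M p"
    by (rule joint_density.intro[OF refl assms(2-6)])
  show ?thesis
    by (intro conjI ballI joint_density.Gap_pred_ge[OF *] joint_density.Gap_ge_prod[OF *]) auto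
qed

end
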